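(* Let $q=e^{\pi i/n}$ with $n>1$. Let $(\Sigma,M)$ be a multiply-holed disk with marked boundary, and let $s,s'$ be trivalent spines for $(\Sigma,M)$. Then the associated skein modules are isomorphic: $C(s)\cong C(s')$.
   Context: Fix $n>1$ and $q=e^{\pi i/n}$. (The number of holes is denoted $h$ here and is unrelated to $n$.) An $h$-holed disk is the compact smooth surface with boundary $\Sigma=\overline{D^2}\setminus\coprod_{i=1}^h D_i^2$ obtained from the closed disk by removing $h$ disjoint open disks from its interior. An $h$-holed disk with marked boundary is a pair $(\Sigma,M)$ with $M$ a finite (possibly empty) set of distinguished points on the boundary of $\Sigma$. A spine for $(\Sigma,M)$ is a planar graph $s$ (loops and multiple edges allowed) embedded in $\Sigma$ such that the set of degree-$1$ vertices of $s$ is precisely $M$ and $\Sigma$ deformation retracts onto $s$. A trivalent spine is a spine all of whose vertices have degree $3$, except those coinciding with the marked boundary points (which have degree 1). A triple $(a,b,c)$ of natural numbers is admissible if $a+b+c$ is even and $a+b\ge c$, $b+c\ge a$, $a+c\ge b$; it is $q$-admissible if it is admissible, $0\le a,b,c\le n-2$ and $a+b+c<2n-2$. A coloring of a trivalent spine $s$ is a labelling of the edges of $s$ by the simple objects $p_0,\dots,p_{n-2}$ (Jones-Wenzl idempotents) of the Temperley-Lieb-Jones category at $q$ — equivalently by integers in $\{0,\dots,n-2\}$ — such that at every trivalent vertex the labels of the three adjacent edges form a $q$-admissible triple. The skein module $C(s)$ associated to $s$ is the free $\mathbb{C}$-module with basis all colorings of $s$. *)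

theory Defs
  imports "HOL-Analysis.Analysis" "HOL-Library.Poly_Mapping"
begin

section \<open>Multiply-holed disks with marked boundary\<close>

text \<open>
  Real smoothness on an open subset of the plane: \<open>D j k\<close> is the iterated partial
  derivative of order \<open>j\<close> in the real and \<open>k\<close> in the imaginary direction.
  (Complex differentiability is not meant.)
\<close>

definition plane_smooth_on :: "complex set \<Rightarrow> (complex \<Rightarrow> complex) \<Rightarrow> bool" where
  "plane_smooth_on U f \<longleftrightarrow>
     (\<exists>D :: nat \<Rightarrow> nat \<Rightarrow> complex \<Rightarrow> complex.
        (\<forall>z\<in>U. D 0 0 z = f z) \<and>
        (\<forall>j k. \<forall>z\<in>U.
           (D j k has_derivative
              (\<lambda>w. Re w *\<^sub>R D (Suc j) k z + Im w *\<^sub>R D j (Suc k) z)) (at z)))"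

text \<open>
  An open disk is the interior of a smoothly embedded closed disk; round disks are the
  special case of an affine embedding.
\<close>

definition smooth_open_disk :: "complex set \<Rightarrow> bool" where
  "smooth_open_disk B \<longleftrightarrow>
     (\<exists>U f g. open U \<and> cball 0 1 \<subseteq> U \<and> open (f ` U) \<and>
        plane_smooth_on U f \<and> plane_smooth_on (f ` U) g \<and>
        (\<forall>z\<in>U. g (f z) = z) \<and>
        B = f ` ball 0 1)"

text \<open>
  The closures of the holes are disjoint from each other and from the outer circle;
  otherwise the result would not be a surface with boundary.
\<close>

definition holed_disk :: "nat \<Rightarrow> complex set \<Rightarrow> bool" where
  "holed_disk h \<Sigma> \<longleftrightarrow>
     (\<exists>B :: nat \<Rightarrow> complex set.
        (\<forall>i<h. smooth_open_disk (B i) \<and> closure (B i) \<subseteq> ball 0 1) \<and>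
        (\<forall>i<h. \<forall>j<h. i \<noteq> j \<longrightarrow> closure (B i) \<inter> closure (B j) = {}) \<and>
        \<Sigma> = cball 0 1 - (\<Union>i<h. B i))"

text \<open>For these regions the boundary of the surface is the topological frontier in the plane.\<close>

definition marked_holed_disk :: "nat \<Rightarrow> complex set \<Rightarrow> complex set \<Rightarrow> bool" where
  "marked_holed_disk h \<Sigma> M \<longleftrightarrow> holed_disk h \<Sigma> \<and> finite M \<and> M \<subseteq> frontier \<Sigma>"


section \<open>Embedded graphs and spines\<close>

text \<open>
  An edge is a name together with a parametrisation of the edge by the unit interval.
  The graph is undirected: none of the notions below depends on the direction of the
  parametrisation.
\<close>

record 'e plane_graph =
  verts :: "complex set"
  edges :: "'e set"
  curve :: "'e \<Rightarrow> real \<Rightarrow> complex"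

definition carrier_of :: "'e plane_graph \<Rightarrow> complex set" where
  "carrier_of s = verts s \<union> (\<Union>e\<in>edges s. path_image (curve s e))"

text \<open>A simple path may be closed, so loops are allowed, as are multiple edges.\<close>

definition embedded_graph :: "complex set \<Rightarrow> 'e plane_graph \<Rightarrow> bool" where
  "embedded_graph \<Sigma> s \<longleftrightarrow>
     finite (verts s) \<and> finite (edges s) \<and> carrier_of s \<subseteq> \<Sigma> \<and>
     (\<forall>e\<in>edges s. simple_path (curve s e) \<and>
        pathstart (curve s e) \<in> verts s \<and> pathfinish (curve s e) \<in> verts s \<and>
        curve s e ` {0<..<1} \<inter> verts s = {}) \<and>
     (\<forall>e\<in>edges s. \<forall>e'\<in>edges s. e \<noteq> e' \<longrightarrow>
        curve s e ` {0<..<1} \<inter> curve s e' ` {0<..<1} = {})"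

text \<open>
  The edge ends at a vertex; \<open>(e, 0)\<close> is the initial and \<open>(e, 1)\<close> the final end of \<open>e\<close>.
  A loop contributes two ends, hence counts twice towards the degree.
\<close>

definition half_edges :: "'e plane_graph \<Rightarrow> complex \<Rightarrow> ('e \<times> real) set" where
  "half_edges s v = {(e, t). e \<in> edges s \<and> t \<in> {0, 1} \<and> curve s e t = v}"

definition vdegree :: "'e plane_graph \<Rightarrow> complex \<Rightarrow> nat" where
  "vdegree s v = card (half_edges s v)"

definition deformation_retracts_onto :: "complex set \<Rightarrow> complex set \<Rightarrow> bool" where
  "deformation_retracts_onto S T \<longleftrightarrow>
     (\<exists>r. homotopic_with_canon (\<lambda>_. True) S S id r \<and> retraction S T r)"

definition spine :: "complex set \<Rightarrow> complex set \<Rightarrow> 'e plane_graph \<Rightarrow> bool" where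
  "spine \<Sigma> M s \<longleftrightarrow>
     embedded_graph \<Sigma> s \<and>
     {v \<in> verts s. vdegree s v = 1} = M \<and>
     deformation_retracts_onto \<Sigma> (carrier_of s)"

definition trivalent_spine :: "complex set \<Rightarrow> complex set \<Rightarrow> 'e plane_graph \<Rightarrow> bool" where
  "trivalent_spine \<Sigma> M s \<longleftrightarrow>
     spine \<Sigma> M s \<and> (\<forall>v \<in> verts s - M. vdegree s v = 3)"


section \<open>Colorings and skein modules\<close>

definition admissible :: "nat \<Rightarrow> nat \<Rightarrow> nat \<Rightarrow> bool" where
  "admissible a b c \<longleftrightarrow> even (a + b + c) \<and> c \<le> a + b \<and> a \<le> b + c \<and> b \<le> a + c"

text \<open>
  The root of unity \<open>q = exp (pi * \<i> / n)\<close> enters only through \<open>n\<close>, and the label \<open>a\<close>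
  stands for the Jones-Wenzl idempotent \<open>p\<^sub>a\<close>.
\<close>

definition q_admissible :: "nat \<Rightarrow> nat \<Rightarrow> nat \<Rightarrow> nat \<Rightarrow> bool" where
  "q_admissible n a b c \<longleftrightarrow>
     admissible a b c \<and> a \<le> n - 2 \<and> b \<le> n - 2 \<and> c \<le> n - 2 \<and> a + b + c < 2 * n - 2"

text \<open>
  The three labels at a trivalent vertex are read off its three edge ends, so that the label
  of a loop occurs twice. Since \<open>q_admissible\<close> is symmetric, the enumeration of the ends is
  irrelevant.
\<close>

definition colorings :: "nat \<Rightarrow> 'e plane_graph \<Rightarrow> ('e \<Rightarrow> nat) set" where
  "colorings n s =
     {c \<in> edges s \<rightarrow>\<^sub>E {0..n - 2}.
        \<forall>v\<in>verts s. \<forall>x y z. vdegree s v = 3 \<longrightarrow> half_edges s v = {x, y, z} \<longrightarrow>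
          q_admissible n (c (fst x)) (c (fst y)) (c (fst z))}"

text \<open>
  The free module over the complex numbers on a set is realised by the finitely supported
  functions on it, with basis the functions \<open>Poly_Mapping.single c 1\<close>.
\<close>

definition cscale :: "complex \<Rightarrow> ('c \<Rightarrow>\<^sub>0 complex) \<Rightarrow> ('c \<Rightarrow>\<^sub>0 complex)" where
  "cscale a x = Poly_Mapping.map ((*) a) x"

definition free_cmodule :: "'c set \<Rightarrow> ('c \<Rightarrow>\<^sub>0 complex) set" where
  "free_cmodule B = {x. Poly_Mapping.keys x \<subseteq> B}"

definition skein_module :: "nat \<Rightarrow> 'e plane_graph \<Rightarrow> (('e \<Rightarrow> nat) \<Rightarrow>\<^sub>0 complex) set" where
  "skein_module n s = free_cmodule (colorings n s)"

definition cmodule_isomorphic ::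
    "('c \<Rightarrow>\<^sub>0 complex) set \<Rightarrow> ('d \<Rightarrow>\<^sub>0 complex) set \<Rightarrow> bool" where
  "cmodule_isomorphic X Y \<longleftrightarrow>
     (\<exists>\<phi>. bij_betw \<phi> X Y \<and>
        (\<forall>x\<in>X. \<forall>y\<in>X. \<phi> (x + y) = \<phi> x + \<phi> y) \<and>
        (\<forall>a. \<forall>x\<in>X. \<phi> (cscale a x) = cscale a (\<phi> x)))"

lemma lookup_cscale: "Poly_Mapping.lookup (cscale a x) c = a * Poly_Mapping.lookup x c"
  unfolding cscale_def by (simp add: Poly_Mapping.map.rep_eq when_def)

interpretation cmodule: vector_space "cscale :: complex \<Rightarrow> ('c \<Rightarrow>\<^sub>0 complex) \<Rightarrow> _"
  by unfold_locales (auto intro!: poly_mapping_eqI simp: lookup_cscale lookup_add algebra_simps)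

lemma subspace_free_cmodule: "cmodule.subspace (free_cmodule B)"
proof -
  have "x + y \<in> free_cmodule B" if "x \<in> free_cmodule B" "y \<in> free_cmodule B"
    for x y :: "'a \<Rightarrow>\<^sub>0 complex"
    using that Poly_Mapping.keys_add[of x y] unfolding free_cmodule_def by blast
  moreover have "cscale a x \<in> free_cmodule B" if "x \<in> free_cmodule B"
    for a and x :: "'a \<Rightarrow>\<^sub>0 complex"
    using that unfolding free_cmodule_def by (auto simp: in_keys_iff lookup_cscale)
  moreover have "0 \<in> free_cmodule B"
    unfolding free_cmodule_def by simp
  ultimately show ?thesis
    unfolding cmodule.subspace_def by blast
qed

lemma span_basis_free_cmodule:
  "cmodule.span ((\<lambda>c. Poly_Mapping.single c 1) ` B) = free_cmodule B"
proof
  show "cmodule.span ((\<lambda>c. Poly_Mapping.single c 1) ` B) \<subseteq> free_cmodule B"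
    by (rule cmodule.span_minimal[OF _ subspace_free_cmodule]) (auto simp: free_cmodule_def)
  show "free_cmodule B \<subseteq> cmodule.span ((\<lambda>c. Poly_Mapping.single c 1) ` B)"
  proof
    fix x assume x: "x \<in> free_cmodule B"
    have "x = (\<Sum>c\<in>Poly_Mapping.keys x.
        cscale (Poly_Mapping.lookup x c) (Poly_Mapping.single c 1))"
      by (rule poly_mapping_eqI)
        (auto simp: lookup_sum lookup_cscale lookup_single when_def in_keys_iff
          if_distrib[of "\<lambda>t. _ * t"] cong: if_cong)
    also have "\<dots> \<in> cmodule.span ((\<lambda>c. Poly_Mapping.single c 1) ` B)"
      using x unfolding free_cmodule_def
      by (intro cmodule.span_sum cmodule.span_scale cmodule.span_base) auto
    finally show "x \<in> cmodule.span ((\<lambda>c. Poly_Mapping.single c 1) ` B)" .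
  qed
qed

lemma independent_basis_free_cmodule:
  "cmodule.independent ((\<lambda>c. Poly_Mapping.single c 1) ` B)"
proof -
  have "Poly_Mapping.single c 1 \<notin> cmodule.span
      ((\<lambda>c. Poly_Mapping.single c 1) ` B - {Poly_Mapping.single c 1})" for c
  proof -
    have "(\<lambda>c. Poly_Mapping.single c 1) ` B - {Poly_Mapping.single c 1}
        \<subseteq> (\<lambda>c. Poly_Mapping.single c (1::complex)) ` (B - {c})"
      by auto
    then have "cmodule.span ((\<lambda>c. Poly_Mapping.single c 1) ` B - {Poly_Mapping.single c 1})
        \<subseteq> free_cmodule (B - {c})"
      using cmodule.span_mono span_basis_free_cmodule by metis
    then show ?thesis
      by (auto simp: free_cmodule_def)
  qed
  then show ?thesis
    unfolding cmodule.dependent_def by auto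
qed

end

theory Submission
  imports Defs
begin

text \<open>
  Both skein modules are free, so it is enough to show that \<open>s\<close> and \<open>s'\<close> have equally many
  colorings. The count turns out to depend on a spine only through its number of marked points
  and its Euler characteristic.

  The labels, with \<open>q\<close>-admissibility as structure constants, form the Verlinde fusion ring, whose
  characters are the functions \<open>a \<mapsto> sin (pi * (a + 1) * j / n) / sin (pi * j / n)\<close> for
  \<open>0 < j < n\<close>. By the discrete sine orthogonality, the indicator of \<open>q\<close>-admissibility is a weighted
  sum over \<open>j\<close> of products of three character values (\<open>verlinde_fusion\<close>), and the constant \<open>1\<close>
  at a marked point is such a sum too. Hence the number of colorings becomes a double sum, over
  edge labels and over an index \<open>j\<close> at each vertex. Summing over the edge labels first, the dual
  orthogonality relation forces the two indices along each edge to agree and contributes one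
  inverse weight. On a connected graph a single global \<open>j\<close> survives, and it contributes
  \<open>w\<^sub>j\<close> to the power of the Euler characteristic times a factor for each marked point
  (\<open>verlinde_state_sum\<close>, \<open>card_colorings\<close>).

  Two topological facts remain. Spines are connected, because a holed disk is connected: a
  locally constant function on the complement of a hole is constant on the connected boundary
  of the hole, so that it extends over the hole (\<open>connected_diff_open\<close>). The Euler characteristic
  is the same for all spines of \<open>\<Sigma>\<close>: the group of circle-valued maps on \<open>\<Sigma>\<close> modulo squares, a
  concrete form of the first cohomology with coefficients in the field with two elements, is
  intrinsic to \<open>\<Sigma>\<close>, and for a connected spine it is the group of sets of edges modulo the
  coboundaries of sets of vertices. It therefore has \<open>2\<close> to the power
  \<open>card edges - card verts + 1\<close> elements (\<open>card_square_classes\<close>).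
\<close>

section \<open>Characters of the fusion ring\<close>

text \<open>
  After multiplication by twice the sine of half the angle the sum telescopes.
\<close>

lemma sum_cos_multiples:
  assumes "0 < k" "k < 2 * n"
  shows "(\<Sum>j = 1..<n. cos (pi * real j * real k / real n)) = (- 1 - (- 1) ^ k) / 2"
proof -
  define \<phi> where "\<phi> = pi * real k / real n"
  have n: "n > 0" using assms by simp
  have "0 < \<phi> / 2" "\<phi> / 2 < pi"
    using assms n unfolding \<phi>_def by (auto simp: field_simps)
  then have nz: "sin (\<phi> / 2) > 0" by (rule sin_gt_zero)
  have tele: "2 * sin (\<phi> / 2) * (\<Sum>j = 1..<m. cos (real j * \<phi>))
      = sin ((real m - 1 / 2) * \<phi>) - sin (\<phi> / 2)" if "m > 0" for m
    using that
  proof (induction m rule: nat_induct_non_zero)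
    case (Suc m)
    have "2 * sin (\<phi> / 2) * cos (real m * \<phi>)
        = sin (\<phi> / 2 + real m * \<phi>) + sin (\<phi> / 2 - real m * \<phi>)"
      unfolding mult.assoc sin_times_cos by simp
    also have "\<phi> / 2 + real m * \<phi> = (real (Suc m) - 1 / 2) * \<phi>" by (simp add: algebra_simps)
    also have "\<phi> / 2 - real m * \<phi> = - ((real m - 1 / 2) * \<phi>)" by (simp add: algebra_simps)
    finally have "2 * sin (\<phi> / 2) * cos (real m * \<phi>)
        = sin ((real (Suc m) - 1 / 2) * \<phi>) - sin ((real m - 1 / 2) * \<phi>)" by simp
    then show ?case using Suc by (simp add: distrib_left)
  qed auto
  have "(real n - 1 / 2) * \<phi> = real k * pi - \<phi> / 2"
    using n unfolding \<phi>_def by (simp add: field_simps)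
  then have "sin ((real n - 1 / 2) * \<phi>) = - ((- 1) ^ k) * sin (\<phi> / 2)"
    by (simp add: sin_diff mult.commute cos_npi2)
  with tele[OF n] have "sin (\<phi> / 2) * (2 * (\<Sum>j = 1..<n. cos (real j * \<phi>)))
      = sin (\<phi> / 2) * (- 1 - (- 1) ^ k)"
    by (simp add: algebra_simps)
  then have "2 * (\<Sum>j = 1..<n. cos (real j * \<phi>)) = - 1 - (- 1) ^ k"
    using nz by simp
  moreover have "real j * \<phi> = pi * real j * real k / real n" for j
    unfolding \<phi>_def by (simp add: field_simps)
  ultimately show ?thesis by simp
qed

text \<open>
  The product of sines is half the difference of the cosines with frequencies \<open>a - b\<close> and \<open>a + b\<close>.
  These have the same parity, so their sums cancel unless \<open>a = b\<close>.
\<close>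

lemma sine_orthogonality:
  assumes "0 < a" "a < n" "0 < b" "b < n"
  shows "(\<Sum>j = 1..<n. sin (pi * real j * real a / real n) * sin (pi * real j * real b / real n))
    = (if a = b then real n / 2 else 0)"
  using assms
proof (induction a b rule: linorder_wlog)
  case (le b a)
  have *: "sin (pi * real j * real b / real n) * sin (pi * real j * real a / real n)
      = (cos (pi * real j * real (a - b) / real n) - cos (pi * real j * real (a + b) / real n)) / 2" for j
  proof -
    have "pi * real j * real b / real n - pi * real j * real a / real n
        = - (pi * real j * real (a - b) / real n)"
      using le by (simp add: of_nat_diff field_simps)
    moreover have "pi * real j * real b / real n + pi * real j * real a / real n
        = pi * real j * real (a + b) / real n"
      by (simp add: add_divide_distrib distrib_left)
    ultimately show ?thesis
      by (simp add: sin_times_sin)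
  qed
  have sum: "(\<Sum>j = 1..<n. cos (pi * real j * real (a + b) / real n)) = (- 1 - (- 1) ^ (a + b)) / 2"
    by (rule sum_cos_multiples) (use le in auto)
  have par: "(- 1) ^ (a - b) = ((- 1) ^ (a + b) :: real)"
    using le by (simp add: minus_one_power_iff)
  show ?case
  proof (cases "a = b")
    case True
    then have "(\<Sum>j = 1..<n. cos (pi * real j * real (a - b) / real n)) = real n - 1"
      using le by simp
    then show ?thesis
      using True sum unfolding * by (simp add: sum_divide_distrib[symmetric] sum_subtractf)
  next
    case False
    then have "(\<Sum>j = 1..<n. cos (pi * real j * real (a - b) / real n)) = (- 1 - (- 1) ^ (a - b)) / 2"
      by (intro sum_cos_multiples) (use le in auto)
    then show ?thesis
      using False sum par unfolding * by (simp add: sum_divide_distrib[symmetric] sum_subtractf)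
  qed
next
  case (sym a b)
  then show ?case by (simp add: mult.commute eq_commute)
qed

text \<open>
  The quantum integer \<open>[k]\<close> at \<open>q\<^sup>j\<close>: the value on the label \<open>k - 1\<close> of the \<open>j\<close>-th character of
  the fusion ring. The shift by one makes the boundary values at \<open>k = 0\<close> and \<open>k = n\<close> vanish.
\<close>

definition quantum_int :: "nat \<Rightarrow> nat \<Rightarrow> nat \<Rightarrow> real" where
  "quantum_int n k j = sin (pi * real j * real k / real n) / sin (pi * real j / real n)"

text \<open>
  The square of the entry of the modular S-matrix in the row of the trivial label and the column of \<open>j\<close>.
\<close>

definition verlinde_weight :: "nat \<Rightarrow> nat \<Rightarrow> real" where
  "verlinde_weight n j = 2 / real n * (sin (pi * real j / real n))\<^sup>2"

lemma sin_node_pos: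
  assumes "0 < j" "j < n"
  shows "sin (pi * real j / real n) > 0"
  using assms by (intro sin_gt_zero) (auto simp: field_simps)

lemma verlinde_weight_pos: "0 < j \<Longrightarrow> j < n \<Longrightarrow> verlinde_weight n j > 0"
  unfolding verlinde_weight_def using sin_node_pos[of j n] by simp

lemma quantum_int_0 [simp]: "quantum_int n 0 j = 0"
  by (simp add: quantum_int_def)

lemma quantum_int_n [simp]: "n > 0 \<Longrightarrow> quantum_int n n j = 0"
  by (simp add: quantum_int_def)

lemma quantum_int_1:
  assumes "0 < j" "j < n"
  shows "quantum_int n (Suc 0) j = 1"
  using sin_node_pos[OF assms] by (simp add: quantum_int_def)

text \<open>
  Multiplication by \<open>[2]\<close> shifts a quantum integer up and down by one; applying this to either
  factor of a product gives the same result.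
\<close>

lemma quantum_int_rec:
  "quantum_int n (Suc (Suc k)) j * quantum_int n (Suc l) j + quantum_int n k j * quantum_int n (Suc l) j
   = quantum_int n (Suc k) j * (quantum_int n (Suc (Suc l)) j + quantum_int n l j)"
proof -
  define \<theta> where "\<theta> = pi * real j / real n"
  have s: "quantum_int n k j = sin (real k * \<theta>) / sin \<theta>" for k
    unfolding quantum_int_def \<theta>_def by (simp add: mult.commute)
  have rec: "quantum_int n (Suc (Suc k)) j + quantum_int n k j = 2 * cos \<theta> * quantum_int n (Suc k) j" for k
  proof -
    have "sin (real (Suc (Suc k)) * \<theta>) + sin (real k * \<theta>) = 2 * (sin (real (Suc k) * \<theta>) * cos \<theta>)"
      unfolding sin_times_cos by (simp add: algebra_simps)
    then show ?thesis
      unfolding s by (simp add: add_divide_distrib[symmetric])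
  qed
  show ?thesis
    unfolding distrib_right[symmetric] rec by (simp add: algebra_simps)
qed

lemma quantum_int_orthonormal:
  assumes "0 < a" "a < n" "0 < b" "b < n"
  shows "(\<Sum>j = 1..<n. verlinde_weight n j * quantum_int n a j * quantum_int n b j) = (if a = b then 1 else 0)"
proof -
  have "verlinde_weight n j * quantum_int n a j * quantum_int n b j
      = 2 / real n * (sin (pi * real j * real a / real n) * sin (pi * real j * real b / real n))"
    if "j \<in> {1..<n}" for j
    using sin_node_pos[of j n] that
    by (simp add: verlinde_weight_def quantum_int_def power2_eq_square)
  then have "(\<Sum>j = 1..<n. verlinde_weight n j * quantum_int n a j * quantum_int n b j)
      = 2 / real n * (\<Sum>j = 1..<n. sin (pi * real j * real a / real n) * sin (pi * real j * real b / real n))"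
    unfolding sum_distrib_left by (rule sum.cong[OF refl])
  then show ?thesis
    unfolding sine_orthogonality[OF assms] using assms by simp
qed

text \<open>
  The sine matrix is symmetric, so the relation dual to \<open>quantum_int_orthonormal\<close> is again the
  sine orthogonality, now with the roles of labels and characters exchanged.
\<close>

lemma quantum_int_complete:
  assumes "0 < i" "i < n" "0 < j" "j < n"
  shows "(\<Sum>a = 1..<n. quantum_int n a i * quantum_int n a j) = (if i = j then 1 / verlinde_weight n i else 0)"
proof -
  have "(\<Sum>a = 1..<n. quantum_int n a i * quantum_int n a j)
      = (\<Sum>a = 1..<n. sin (pi * real a * real i / real n) * sin (pi * real a * real j / real n))
        / (sin (pi * real i / real n) * sin (pi * real j / real n))"
    by (simp add: quantum_int_def sum_divide_distrib mult_ac)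
  then show ?thesis
    using sine_orthogonality[OF assms]
    by (simp add: verlinde_weight_def power2_eq_square)
qed

text \<open>
  \<open>q\<close>-admissibility with all labels raised by one. In this form the condition fails by itself as
  soon as a label is \<open>0\<close> or \<open>n\<close>, in accordance with the zeros of the quantum integers, so that the
  recursion below has no boundary cases.
\<close>

definition fusion :: "nat \<Rightarrow> nat \<Rightarrow> nat \<Rightarrow> nat \<Rightarrow> bool" where
  "fusion n k l m \<longleftrightarrow> odd (k + l + m) \<and> m < k + l \<and> k < l + m \<and> l < k + m \<and> k + l + m < 2 * n"

lemma q_admissible_iff_fusion:
  assumes "n > 1"
  shows "q_admissible n a b c \<longleftrightarrow>
    a \<le> n - 2 \<and> b \<le> n - 2 \<and> c \<le> n - 2 \<and> fusion n (Suc a) (Suc b) (Suc c)"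
proof -
  have "even (a + b + c) \<longleftrightarrow> odd (Suc a + Suc b + Suc c)" by simp
  moreover have "a + b + c < 2 * n - 2 \<longleftrightarrow> Suc a + Suc b + Suc c < 2 * n" if "even (a + b + c)"
  proof -
    have "a + b + c + 3 \<noteq> 2 * n" using that by presburger
    then show ?thesis using assms by linarith
  qed
  ultimately show ?thesis
    unfolding q_admissible_def admissible_def fusion_def less_Suc_eq_le by auto
qed

text \<open>
  The structure constants obey the same recursion as the products in \<open>quantum_int_rec\<close>.
\<close>

lemma fusion_rec:
  assumes "Suc (Suc k) \<le> n" "Suc l < n" "m \<le> n"
  shows "of_bool (fusion n (Suc (Suc k)) (Suc l) m) + of_bool (fusion n k (Suc l) m)
    = (of_bool (fusion n (Suc k) (Suc (Suc l)) m) + of_bool (fusion n (Suc k) l m) :: real)"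
proof (cases "even (k + l + m)")
  case True
  then obtain p where p: "k + l + m = 2 * p" by (elim evenE)
  \<comment> \<open>In terms of half the sum the triangle inequalities become bounds on the single labels.\<close>
  have F: "fusion n (Suc (Suc k)) (Suc l) m \<longleftrightarrow> m < p + 2 \<and> k < p \<and> l < p + 1 \<and> p + 1 < n"
    "fusion n k (Suc l) m \<longleftrightarrow> m < p + 1 \<and> k < p + 1 \<and> l < p \<and> p < n"
    "fusion n (Suc k) (Suc (Suc l)) m \<longleftrightarrow> m < p + 2 \<and> k < p + 1 \<and> l < p \<and> p + 1 < n"
    "fusion n (Suc k) l m \<longleftrightarrow> m < p + 1 \<and> k < p \<and> l < p + 1 \<and> p < n"
    using True p unfolding fusion_def by (auto simp del: dvd_add_right_iff)
  show ?thesis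
    using assms p unfolding F of_bool_def by (auto; linarith)
next
  case False
  then show ?thesis unfolding fusion_def by simp
qed

text \<open>
  The Verlinde formula. Both sides satisfy the same recursion in \<open>k\<close>, agree for \<open>k = 1\<close> by
  orthonormality, and vanish for \<open>k = 0\<close> and when \<open>l\<close> or \<open>m\<close> is \<open>0\<close> or \<open>n\<close>.
\<close>

theorem verlinde_fusion:
  assumes "k \<le> n" "l \<le> n" "m \<le> n"
  shows "(\<Sum>j = 1..<n. verlinde_weight n j * quantum_int n k j * quantum_int n l j * quantum_int n m j)
    = of_bool (fusion n k l m)"
  using assms
proof (induction k arbitrary: l m rule: nat_less_induct)
  case (1 k)
  show ?case
  proof (cases "0 < l \<and> l < n \<and> 0 < m \<and> m < n")
    case False
    then have "l = 0 \<or> l = n \<or> m = 0 \<or> m = n" using 1 by auto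
    moreover have "\<not> fusion n k l m"
      using calculation \<open>k \<le> n\<close> by (auto simp: fusion_def)
    ultimately show ?thesis
      by (cases "n = 0") auto
  next
    case True
    consider "k = 0" | "k = 1" | k' where "k = Suc (Suc k')"
      by (metis One_nat_def not0_implies_Suc)
    then show ?thesis
    proof cases
      case 1
      then show ?thesis by (simp add: fusion_def)
    next
      case 2
      then have "(\<Sum>j = 1..<n. verlinde_weight n j * quantum_int n k j * quantum_int n l j * quantum_int n m j)
          = (\<Sum>j = 1..<n. verlinde_weight n j * quantum_int n l j * quantum_int n m j)"
        by (intro sum.cong) (auto simp: quantum_int_1)
      also have "\<dots> = of_bool (l = m)"
        using quantum_int_orthonormal[of l n m] True by simp
      also have "(l = m) = fusion n k l m"
        using 2 True by (auto simp: fusion_def)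
      finally show ?thesis .
    next
      case (3 k')
      obtain l' where l': "l = Suc l'" using True by (cases l) auto
      let ?T = "\<lambda>k l m. \<Sum>j = 1..<n. verlinde_weight n j * quantum_int n k j * quantum_int n l j * quantum_int n m j"
      have "?T k l m + ?T k' l m = ?T (Suc k') (Suc l) m + ?T (Suc k') l' m"
        unfolding sum.distrib[symmetric]
      proof (rule sum.cong[OF refl])
        fix j
        have "verlinde_weight n j * (quantum_int n k j * quantum_int n l j + quantum_int n k' j * quantum_int n l j) * quantum_int n m j
          = verlinde_weight n j * (quantum_int n (Suc k') j * (quantum_int n (Suc l) j + quantum_int n l' j)) * quantum_int n m j"
          using quantum_int_rec[of n k' j l'] 3 l' by simp
        then show "verlinde_weight n j * quantum_int n k j * quantum_int n l j * quantum_int n m j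
          + verlinde_weight n j * quantum_int n k' j * quantum_int n l j * quantum_int n m j
          = verlinde_weight n j * quantum_int n (Suc k') j * quantum_int n (Suc l) j * quantum_int n m j
          + verlinde_weight n j * quantum_int n (Suc k') j * quantum_int n l' j * quantum_int n m j"
          by (simp add: algebra_simps)
      qed
      moreover have "?T k' l m = of_bool (fusion n k' l m)"
        "?T (Suc k') (Suc l) m = of_bool (fusion n (Suc k') (Suc l) m)"
        "?T (Suc k') l' m = of_bool (fusion n (Suc k') l' m)"
        using 1 3 True l' by auto
      ultimately show ?thesis
        using fusion_rec[of k' n l' m] 1 3 True l' by simp
    qed
  qed
qed

section \<open>State sums on connected graphs\<close>

text \<open>
  Exchanging the product over vertices with the sum over \<open>J\<close> yields a sum over functions
  \<open>V \<rightarrow> J\<close>. For a fixed function the sum over labelings factors over the edges, and by the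
  completeness relation an edge annihilates every function that differs at its two ends. The
  connectivity hypothesis leaves the constant functions.
\<close>

lemma verlinde_state_sum:
  fixes incidence :: "'e \<Rightarrow> real \<Rightarrow> 'v" and x :: "'l \<Rightarrow> 'j \<Rightarrow> real"
  assumes fin: "finite V" "finite E" "finite L" "finite J"
    and ends: "\<And>e. e \<in> E \<Longrightarrow> incidence e 0 \<in> V \<and> incidence e 1 \<in> V"
    and V: "V \<noteq> {}"
    and conn: "\<And>f :: 'v \<Rightarrow> 'j. \<forall>e\<in>E. f (incidence e 0) = f (incidence e 1) \<Longrightarrow> \<exists>k. \<forall>v\<in>V. f v = k"
    and complete: "\<And>i j. i \<in> J \<Longrightarrow> j \<in> J \<Longrightarrow> (\<Sum>a\<in>L. x a i * x a j) = (if i = j then 1 / w i else 0)"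
  shows "(\<Sum>c\<in>E \<rightarrow>\<^sub>E L. \<Prod>v\<in>V. \<Sum>j\<in>J. w j * W v j *
            (\<Prod>h\<in>{(e, t). e \<in> E \<and> t \<in> {0, 1} \<and> incidence e t = v}. x (c (fst h)) j))
       = (\<Sum>j\<in>J. (\<Prod>v\<in>V. W v j) * w j ^ card V / w j ^ card E)"
proof -
  let ?H = "E \<times> {0, 1 :: real}"
  let ?at = "\<lambda>h. incidence (fst h) (snd h)"
  have H: "{(e, t). e \<in> E \<and> t \<in> {0, 1} \<and> incidence e t = v} = {h. h \<in> ?H \<and> ?at h = v}" for v
    by auto
  have regroup: "(\<Prod>v\<in>V. \<Prod>h\<in>{h. h \<in> ?H \<and> ?at h = v}. x (c (fst h)) (j v))
      = (\<Prod>e\<in>E. x (c e) (j (incidence e 0)) * x (c e) (j (incidence e 1)))" for c j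
  proof -
    have "(\<Prod>v\<in>V. \<Prod>h\<in>{h. h \<in> ?H \<and> ?at h = v}. x (c (fst h)) (j v))
        = (\<Prod>v\<in>V. \<Prod>h\<in>{h. h \<in> ?H \<and> ?at h = v}. x (c (fst h)) (j (?at h)))"
      by (intro prod.cong refl) auto
    also have "\<dots> = (\<Prod>h\<in>?H. x (c (fst h)) (j (?at h)))"
      by (rule prod.group) (use fin ends in auto)
    also have "\<dots> = (\<Prod>e\<in>E. \<Prod>t\<in>{0, 1}. x (c e) (j (incidence e t)))"
      unfolding prod.cartesian_product by (rule prod.cong) auto
    finally show ?thesis by simp
  qed
  \<comment> \<open>An edge whose two ends carry different indices kills the whole product.\<close>
  have edge_zero: "(\<Prod>e\<in>E. \<Sum>a\<in>L. x a (j (incidence e 0)) * x a (j (incidence e 1))) = 0"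
    if j: "j \<in> V \<rightarrow>\<^sub>E J" and nonconst: "\<not> (\<exists>k\<in>J. \<forall>v\<in>V. j v = k)" for j
  proof -
    have "\<not> (\<forall>e\<in>E. j (incidence e 0) = j (incidence e 1))"
    proof
      assume "\<forall>e\<in>E. j (incidence e 0) = j (incidence e 1)"
      from conn[OF this] obtain k where k: "\<forall>v\<in>V. j v = k" by blast
      obtain v where "v \<in> V" using V by blast
      then have "k \<in> J" using k j by auto
      then show False using nonconst k by blast
    qed
    then obtain e where e: "e \<in> E" "j (incidence e 0) \<noteq> j (incidence e 1)" by blast
    then have "(\<Sum>a\<in>L. x a (j (incidence e 0)) * x a (j (incidence e 1))) = 0"
      using complete[of "j (incidence e 0)" "j (incidence e 1)"] ends[OF e(1)] j by auto
    then show ?thesis using fin e by (auto simp: prod_zero_iff)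
  qed
  have "(\<Sum>c\<in>E \<rightarrow>\<^sub>E L. \<Prod>v\<in>V. \<Sum>j\<in>J. w j * W v j * (\<Prod>h\<in>{h. h \<in> ?H \<and> ?at h = v}. x (c (fst h)) j))
      = (\<Sum>c\<in>E \<rightarrow>\<^sub>E L. \<Sum>j\<in>V \<rightarrow>\<^sub>E J. \<Prod>v\<in>V. w (j v) * W v (j v) *
          (\<Prod>h\<in>{h. h \<in> ?H \<and> ?at h = v}. x (c (fst h)) (j v)))"
    using fin by (simp add: prod_sum_PiE)
  also have "\<dots> = (\<Sum>j\<in>V \<rightarrow>\<^sub>E J. \<Sum>c\<in>E \<rightarrow>\<^sub>E L. (\<Prod>v\<in>V. w (j v) * W v (j v)) *
      (\<Prod>e\<in>E. x (c e) (j (incidence e 0)) * x (c e) (j (incidence e 1))))"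
    by (subst sum.swap) (simp only: prod.distrib regroup)
  also have "\<dots> = (\<Sum>j\<in>V \<rightarrow>\<^sub>E J. (\<Prod>v\<in>V. w (j v) * W v (j v)) *
      (\<Prod>e\<in>E. \<Sum>a\<in>L. x a (j (incidence e 0)) * x a (j (incidence e 1))))"
    using fin by (simp add: prod_sum_PiE sum_distrib_left)
  also have "\<dots> = (\<Sum>j\<in>(\<lambda>k. restrict (\<lambda>_. k) V) ` J. (\<Prod>v\<in>V. w (j v) * W v (j v)) *
      (\<Prod>e\<in>E. \<Sum>a\<in>L. x a (j (incidence e 0)) * x a (j (incidence e 1))))"
  proof (rule sum.mono_neutral_right)
    show "\<forall>j\<in>(V \<rightarrow>\<^sub>E J) - (\<lambda>k. restrict (\<lambda>_. k) V) ` J. (\<Prod>v\<in>V. w (j v) * W v (j v)) *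
      (\<Prod>e\<in>E. \<Sum>a\<in>L. x a (j (incidence e 0)) * x a (j (incidence e 1))) = 0"
    proof
      fix j assume j: "j \<in> (V \<rightarrow>\<^sub>E J) - (\<lambda>k. restrict (\<lambda>_. k) V) ` J"
      have "\<not> (\<exists>k\<in>J. \<forall>v\<in>V. j v = k)"
      proof
        assume "\<exists>k\<in>J. \<forall>v\<in>V. j v = k"
        then obtain k where "k \<in> J" "\<forall>v\<in>V. j v = k" by blast
        then have "j = restrict (\<lambda>_. k) V" using j by (auto simp: PiE_def extensional_def fun_eq_iff)
        then show False using j \<open>k \<in> J\<close> by blast
      qed
      then show "(\<Prod>v\<in>V. w (j v) * W v (j v)) *
        (\<Prod>e\<in>E. \<Sum>a\<in>L. x a (j (incidence e 0)) * x a (j (incidence e 1))) = 0"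
        using edge_zero[of j] j by auto
    qed
  qed (use fin in \<open>auto intro!: finite_PiE\<close>)
  also have "\<dots> = (\<Sum>k\<in>J. (\<Prod>v\<in>V. w k * W v k) * (1 / w k ^ card E))"
  proof (subst sum.reindex)
    show "inj_on (\<lambda>k. restrict (\<lambda>_. k) V) J"
      using V by (auto simp: inj_on_def restrict_def fun_eq_iff split: if_splits)
    show "sum ((\<lambda>j. (\<Prod>v\<in>V. w (j v) * W v (j v)) *
        (\<Prod>e\<in>E. \<Sum>a\<in>L. x a (j (incidence e 0)) * x a (j (incidence e 1)))) \<circ> (\<lambda>k. restrict (\<lambda>_. k) V)) J
      = (\<Sum>k\<in>J. (\<Prod>v\<in>V. w k * W v k) * (1 / w k ^ card E))"
      using ends complete by (intro sum.cong) (auto simp: power_one_over)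
  qed
  also have "\<dots> = (\<Sum>j\<in>J. (\<Prod>v\<in>V. W v j) * w j ^ card V / w j ^ card E)"
    by (simp add: prod.distrib mult.commute)
  finally show ?thesis
    unfolding H .
qed

section \<open>Functions on embedded graphs\<close>

lemma embedded_graph_curve_ends:
  assumes "embedded_graph \<Sigma> s" "e \<in> edges s"
  shows "curve s e 0 \<in> verts s" "curve s e 1 \<in> verts s"
  using assms by (auto simp: embedded_graph_def pathstart_def pathfinish_def)

lemma embedded_graph_curve_in_verts:
  assumes "embedded_graph \<Sigma> s" "e \<in> edges s" "t \<in> {0..1}" "curve s e t \<in> verts s"
  shows "t = 0 \<or> t = 1"
proof (rule ccontr)
  assume "\<not> ?thesis"
  then have "t \<in> {0<..<1}" using assms(3) by auto
  then show False using assms unfolding embedded_graph_def by blast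
qed

text \<open>
  A point in the interior of an edge determines both the edge and the parameter.
\<close>

lemma embedded_graph_overlap:
  assumes s: "embedded_graph \<Sigma> s" and e: "e \<in> edges s" "t \<in> {0..1}"
    and e': "e' \<in> edges s" "t' \<in> {0..1}"
    and eq: "curve s e t = curve s e' t'" and inner: "curve s e t \<notin> verts s"
  shows "e = e' \<and> t = t'"
proof -
  have t: "t \<in> {0<..<1}" "t' \<in> {0<..<1}"
    using embedded_graph_curve_ends[OF s e(1)] embedded_graph_curve_ends[OF s e'(1)] e e' eq inner
    by (auto simp: less_le)
  then have "e = e'"
    using s e(1) e'(1) eq unfolding embedded_graph_def by blast
  moreover have "simple_path (curve s e)"
    using s e unfolding embedded_graph_def by blast
  ultimately show ?thesis
    using eq e e' t unfolding simple_path_def loop_free_def by fastforce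
qed

lemma curve_in_carrier:
  assumes "e \<in> edges s" "t \<in> {0..1}"
  shows "curve s e t \<in> carrier_of s"
  using assms unfolding carrier_of_def path_image_def by blast

lemma continuous_on_curve:
  assumes "embedded_graph \<Sigma> s" "e \<in> edges s" "continuous_on (carrier_of s) f"
  shows "continuous_on {0..1} (\<lambda>t. f (curve s e t))"
proof (rule continuous_on_compose2[OF assms(3)])
  show "continuous_on {0..1} (curve s e)"
    using assms(1,2) by (auto simp: embedded_graph_def simple_path_def path_def)
  show "curve s e ` {0..1} \<subseteq> carrier_of s"
    using curve_in_carrier[OF assms(2)] by blast
qed

lemma carrier_cases:
  assumes "z \<in> carrier_of s"
  obtains "z \<in> verts s" | e t where "e \<in> edges s" "t \<in> {0..1}" "z = curve s e t"
  using assms by (auto simp: carrier_of_def path_image_def)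

text \<open>
  A path is a closed map onto its image by compactness, hence a quotient map.
\<close>

lemma continuous_on_path_image:
  fixes p :: "real \<Rightarrow> 'a::t2_space" and g :: "'a \<Rightarrow> 'b::topological_space"
  assumes "path p" "continuous_on {0..1} (g \<circ> p)"
  shows "continuous_on (path_image p) g"
  unfolding continuous_on_closed_invariant
proof (intro allI impI)
  fix B :: "'b set" assume "closed B"
  have "closed ({0..1} \<inter> (g \<circ> p) -` B)"
    using assms(2) \<open>closed B\<close> by (intro continuous_closed_preimage) auto
  then have "compact ({0..1} \<inter> ({0..1} \<inter> (g \<circ> p) -` B))"
    by (intro compact_Int_closed) auto
  then have "compact (p ` ({0..1} \<inter> (g \<circ> p) -` B))"
    using assms(1) unfolding path_def
    by (intro compact_continuous_image) (auto intro: continuous_on_subset)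
  then show "\<exists>A. closed A \<and> A \<inter> path_image p = g -` B \<inter> path_image p"
    by (intro exI[of _ "p ` ({0..1} \<inter> (g \<circ> p) -` B)"]) (auto simp: compact_imp_closed path_image_def)
qed

text \<open>
  Edges meet only at vertices, so functions on the edges that match at the vertices paste
  together; finitely many closed pieces make the result continuous.
\<close>

lemma glue_on_graph:
  fixes \<phi> :: "complex \<Rightarrow> 'b::topological_space" and \<psi> :: "'e \<Rightarrow> real \<Rightarrow> 'b"
  assumes s: "embedded_graph \<Sigma> s"
    and cont: "\<And>e. e \<in> edges s \<Longrightarrow> continuous_on {0..1} (\<psi> e)"
    and ends: "\<And>e. e \<in> edges s \<Longrightarrow> \<psi> e 0 = \<phi> (curve s e 0) \<and> \<psi> e 1 = \<phi> (curve s e 1)"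
  obtains g where "continuous_on (carrier_of s) g"
    and "\<And>v. v \<in> verts s \<Longrightarrow> g v = \<phi> v"
    and "\<And>e t. e \<in> edges s \<Longrightarrow> t \<in> {0..1} \<Longrightarrow> g (curve s e t) = \<psi> e t"
proof -
  define g where "g z = (if z \<in> verts s then \<phi> z
    else SOME y. \<exists>e\<in>edges s. \<exists>t\<in>{0..1}. z = curve s e t \<and> y = \<psi> e t)" for z
  have vert: "g v = \<phi> v" if "v \<in> verts s" for v
    using that by (simp add: g_def)
  have edge: "g (curve s e t) = \<psi> e t" if e: "e \<in> edges s" "t \<in> {0..1}" for e t
  proof (cases "curve s e t \<in> verts s")
    case True
    then show ?thesis
      using vert embedded_graph_curve_in_verts[OF s e] ends[OF e(1)] by auto
  next
    case False
    have "\<exists>y. \<exists>e'\<in>edges s. \<exists>t'\<in>{0..1}. curve s e t = curve s e' t' \<and> y = \<psi> e' t'"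
      using e by blast
    from someI_ex[OF this] obtain e' t' where
      *: "e' \<in> edges s" "t' \<in> {0..1}" "curve s e t = curve s e' t'" "g (curve s e t) = \<psi> e' t'"
      using False by (auto simp: g_def)
    have "e = e' \<and> t = t'"
      using embedded_graph_overlap[OF s e *(1-3) False] .
    then show ?thesis using * by simp
  qed
  have "continuous_on (path_image (curve s e)) g" if e: "e \<in> edges s" for e
  proof (rule continuous_on_path_image)
    show "path (curve s e)"
      using s e by (auto simp: embedded_graph_def simple_path_imp_path)
    show "continuous_on {0..1} (g \<circ> curve s e)"
      using cont[OF e] by (rule continuous_on_eq) (simp add: edge e)
  qed
  then have "continuous_on (\<Union>e\<in>edges s. path_image (curve s e)) g"
    using s by (intro continuous_on_closed_Union)
      (auto simp: embedded_graph_def intro!: closed_path_image simple_path_imp_path)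
  moreover have "continuous_on (verts s) g"
    using s by (intro continuous_on_finite) (auto simp: embedded_graph_def)
  moreover have "closed (\<Union>e\<in>edges s. path_image (curve s e))"
    using s by (intro closed_UN) (auto simp: embedded_graph_def intro!: closed_path_image simple_path_imp_path)
  ultimately have "continuous_on (carrier_of s) g"
    unfolding carrier_of_def using s
    by (intro continuous_on_closed_Un) (auto simp: embedded_graph_def finite_imp_closed)
  then show thesis using vert edge by (rule that)
qed

text \<open>
  Topological connectedness implies the combinatorial one: the indicator of one level set of \<open>f\<close>
  extends along the edges to a continuous function with at most two values.
\<close>

lemma constant_on_connected_graph:
  assumes s: "embedded_graph \<Sigma> s" and conn: "connected (carrier_of s)"
    and f: "\<forall>e\<in>edges s. f (curve s e 0) = f (curve s e 1)"
  shows "\<exists>k. \<forall>v\<in>verts s. f v = k"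
proof (cases "verts s = {}")
  case False
  then obtain u where u: "u \<in> verts s" by blast
  obtain g where g: "continuous_on (carrier_of s) g"
      "\<And>v. v \<in> verts s \<Longrightarrow> g v = (if f v = f u then 1 else 0 :: real)"
      "\<And>e t. e \<in> edges s \<Longrightarrow> t \<in> {0..1} \<Longrightarrow> g (curve s e t) = (if f (curve s e 0) = f u then 1 else 0)"
    by (rule glue_on_graph[OF s, of "\<lambda>e t. if f (curve s e 0) = f u then 1 else 0 :: real"
        "\<lambda>v. if f v = f u then 1 else 0"]) (use f in auto)
  have "g ` carrier_of s \<subseteq> {0, 1}"
    by (auto elim!: carrier_cases simp: g split: if_splits)
  then have "finite (g ` carrier_of s)"
    by (rule finite_subset) simp
  then have "g constant_on carrier_of s"
    using conn g(1) by (simp add: continuous_finite_range_constant)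
  then have "\<forall>v\<in>verts s. g v = g u"
    using u unfolding constant_on_def carrier_of_def by (metis UnI1)
  then show ?thesis using u g(2) by (metis zero_neq_one)
qed simp

section \<open>Circle-valued maps modulo squares\<close>

definition circle_maps :: "complex set \<Rightarrow> (complex \<Rightarrow> complex) set" where
  "circle_maps S = {f. continuous_on S f \<and> f \<in> S \<rightarrow> sphere 0 1}"

definition square_on :: "complex set \<Rightarrow> (complex \<Rightarrow> complex) \<Rightarrow> bool" where
  "square_on S f \<longleftrightarrow> (\<exists>h. continuous_on S h \<and> (\<forall>x\<in>S. f x = (h x)\<^sup>2))"

text \<open>
  Since \<open>f / g = f * g / g\<^sup>2\<close>, the product is a square exactly when the quotient is, so this is
  congruence modulo squares. The quotient is a concrete model of the image of the first integral
  cohomology in the cohomology with coefficients in the field with two elements.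
\<close>

definition square_rel :: "complex set \<Rightarrow> ((complex \<Rightarrow> complex) \<times> (complex \<Rightarrow> complex)) set" where
  "square_rel S = {(f, g). f \<in> circle_maps S \<and> g \<in> circle_maps S \<and> square_on S (\<lambda>x. f x * g x)}"

lemma circle_maps_nonzero: "f \<in> circle_maps S \<Longrightarrow> x \<in> S \<Longrightarrow> f x \<noteq> 0"
  by (auto simp: circle_maps_def Pi_iff)

lemma circle_maps_compose:
  assumes "f \<in> circle_maps T" "continuous_on S r" "r \<in> S \<rightarrow> T"
  shows "(\<lambda>x. f (r x)) \<in> circle_maps S"
proof -
  have f: "continuous_on T f" "\<And>x. x \<in> T \<Longrightarrow> f x \<in> sphere 0 1"
    using assms(1) by (auto simp: circle_maps_def)
  have "continuous_on S (\<lambda>x. f (r x))"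
    by (rule continuous_on_compose2[OF f(1) assms(2)]) (use assms(3) in blast)
  then show ?thesis
    using f(2) assms(3) unfolding circle_maps_def by blast
qed

lemma square_on_cong: "(\<And>x. x \<in> S \<Longrightarrow> f x = g x) \<Longrightarrow> square_on S f \<longleftrightarrow> square_on S g"
  by (simp add: square_on_def)

lemma square_on_compose:
  assumes "square_on T f" "continuous_on S r" "r \<in> S \<rightarrow> T"
  shows "square_on S (\<lambda>x. f (r x))"
proof -
  obtain h where h: "continuous_on T h" "\<forall>x\<in>T. f x = (h x)\<^sup>2"
    using assms(1) unfolding square_on_def by blast
  have "continuous_on S (\<lambda>x. h (r x))"
    using assms(2,3) by (intro continuous_on_compose2[OF h(1)]) auto
  then show ?thesis
    unfolding square_on_def using h(2) assms(3) by blast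
qed

lemma square_on_trans:
  assumes "square_on S (\<lambda>x. f x * g x)" "square_on S (\<lambda>x. g x * k x)" "g \<in> circle_maps S"
  shows "square_on S (\<lambda>x. f x * k x)"
proof -
  obtain h l where h: "continuous_on S h" "\<forall>x\<in>S. f x * g x = (h x)\<^sup>2"
      and l: "continuous_on S l" "\<forall>x\<in>S. g x * k x = (l x)\<^sup>2"
    using assms unfolding square_on_def by blast
  have "continuous_on S (\<lambda>x. h x * l x / g x)"
    using assms(3) circle_maps_nonzero[OF assms(3)]
    by (intro continuous_intros h l) (auto simp: circle_maps_def)
  moreover have "f x * k x = (h x * l x / g x)\<^sup>2" if "x \<in> S" for x
  proof -
    have "(h x * l x / g x)\<^sup>2 = (f x * g x) * (g x * k x) / (g x)\<^sup>2"
      using h l that by (simp add: power_mult_distrib power_divide)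
    then show ?thesis
      using circle_maps_nonzero[OF assms(3) that] by (simp add: power2_eq_square)
  qed
  ultimately show ?thesis
    unfolding square_on_def by blast
qed

lemma equiv_square_rel: "equiv (circle_maps S) (square_rel S)"
proof (rule equivI)
  show "square_rel S \<subseteq> circle_maps S \<times> circle_maps S"
    unfolding square_rel_def by auto
  show "refl_on (circle_maps S) (square_rel S)"
    unfolding refl_on_def square_rel_def square_on_def circle_maps_def
    by (auto simp: power2_eq_square)
  show "sym (square_rel S)"
    unfolding sym_def square_rel_def by (auto simp: mult.commute)
  show "trans (square_rel S)"
    unfolding trans_def square_rel_def using square_on_trans by blast
qed

text \<open>
  Homotopic circle-valued maps differ by a factor with a continuous logarithm, and half of the
  logarithm gives a square root of this factor.
\<close>

lemma square_on_homotopic: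
  assumes f: "f \<in> circle_maps S" and r: "homotopic_with_canon (\<lambda>_. True) S S id r"
  shows "square_on S (\<lambda>x. f x * f (r x))"
proof -
  have contr: "continuous_on S r" "r \<in> S \<rightarrow> S"
    using homotopic_with_imp_continuous[OF r] homotopic_with_imp_subset2[OF r] by auto
  have "homotopic_with_canon (\<lambda>_. True) S (sphere 0 1) (f \<circ> id) (f \<circ> r)"
    by (rule homotopic_with_compose_continuous_left[OF r]) (use f in \<open>auto simp: circle_maps_def\<close>)
  then have "\<exists>c. homotopic_with_canon (\<lambda>_. True) S (sphere 0 1) (\<lambda>x. f x / f (r x)) (\<lambda>x. c)"
    by (subst (asm) homotopic_circlemaps_divide) auto
  then obtain g where g: "continuous_on S g" "\<forall>x\<in>S. f x / f (r x) = exp (\<i> * of_real (g x))"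
    unfolding inessential_eq_continuous_logarithm_circle by blast
  have cfr: "continuous_on S (\<lambda>x. f (r x))"
    using circle_maps_compose[OF f contr] by (simp add: circle_maps_def)
  show ?thesis
    unfolding square_on_def
  proof (intro exI conjI ballI)
    show "continuous_on S (\<lambda>x. f (r x) * exp (\<i> * of_real (g x) / 2))"
      by (intro continuous_intros cfr g) auto
    fix x assume x: "x \<in> S"
    then have nz: "f (r x) \<noteq> 0"
      using contr(2) by (intro circle_maps_nonzero[OF f]) blast
    have "(exp (\<i> * of_real (g x) / 2))\<^sup>2 = f x / f (r x)"
      using g(2) x by (simp add: exp_double[symmetric])
    then have "(f (r x) * exp (\<i> * of_real (g x) / 2))\<^sup>2 = (f (r x))\<^sup>2 * (f x / f (r x))"
      by (simp only: power_mult_distrib)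
    then show "f x * f (r x) = (f (r x) * exp (\<i> * of_real (g x) / 2))\<^sup>2"
      using nz by (simp add: power2_eq_square)
  qed
qed

lemma edge_twist_exists:
  assumes s: "embedded_graph \<Sigma> s"
  shows "\<exists>f. f \<in> circle_maps (carrier_of s) \<and> (\<forall>v\<in>verts s. f v = 1) \<and>
    (\<forall>e\<in>edges s. \<forall>t\<in>{0..1::real}. f (curve s e t) = (if e \<in> A then exp (2 * pi * \<i> * t) else 1))"
proof -
  obtain g where g: "continuous_on (carrier_of s) g"
    "\<And>v. v \<in> verts s \<Longrightarrow> g v = 1"
    "\<And>e t::real. e \<in> edges s \<Longrightarrow> t \<in> {0..1} \<Longrightarrow> g (curve s e t) = (if e \<in> A then exp (2 * pi * \<i> * t) else 1)"
  proof (rule glue_on_graph[OF s, of "\<lambda>e (t::real). if e \<in> A then exp (2 * pi * \<i> * t) else 1" "\<lambda>_. 1"])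
    show "continuous_on {0..1} (\<lambda>t::real. if e \<in> A then exp (2 * pi * \<i> * t) else 1)" for e
      by (cases "e \<in> A") (auto intro!: continuous_intros)
  qed auto
  have "norm (g z) = 1" if "z \<in> carrier_of s" for z
    using that by (cases rule: carrier_cases) (auto simp: g)
  then show ?thesis
    using g by (intro exI[of _ g]) (auto simp: circle_maps_def)
qed

text \<open>
  The cocycle with support \<open>A\<close>, realised as a map that winds once around the circle along each
  edge in \<open>A\<close> and is constant elsewhere.
\<close>

definition edge_twist :: "'e plane_graph \<Rightarrow> 'e set \<Rightarrow> complex \<Rightarrow> complex" where
  "edge_twist s A = (SOME f. f \<in> circle_maps (carrier_of s) \<and> (\<forall>v\<in>verts s. f v = 1) \<and>
    (\<forall>e\<in>edges s. \<forall>t\<in>{0..1::real}. f (curve s e t) = (if e \<in> A then exp (2 * pi * \<i> * t) else 1)))"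

lemma edge_twist:
  fixes t :: real
  assumes "embedded_graph \<Sigma> s"
  shows "edge_twist s A \<in> circle_maps (carrier_of s)"
    and "v \<in> verts s \<Longrightarrow> edge_twist s A v = 1"
    and "e \<in> edges s \<Longrightarrow> t \<in> {0..1} \<Longrightarrow>
      edge_twist s A (curve s e t) = (if e \<in> A then exp (2 * pi * \<i> * t) else 1)"
  using someI_ex[OF edge_twist_exists[OF assms, of A]] unfolding edge_twist_def by auto

text \<open>
  Edge twists represent all classes. On every edge a square root of \<open>f\<close> can be chosen which
  starts at a prescribed root at the initial vertex. It may arrive at the wrong root at the final
  vertex, and exactly on these edges a twist corrects the sign.
\<close>

lemma square_on_graph_twist:
  assumes s: "embedded_graph \<Sigma> s" and f: "f \<in> circle_maps (carrier_of s)"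
  shows "\<exists>A\<subseteq>edges s. square_on (carrier_of s) (\<lambda>x. f x * edge_twist s A x)"
proof -
  have "\<exists>q. continuous_on {0..1} q \<and> (\<forall>t\<in>{0..1}. f (curve s e t) = (q t)\<^sup>2) \<and> q 0 = csqrt (f (curve s e 0))"
    if e: "e \<in> edges s" for e
  proof -
    have cont: "continuous_on {0..1} (\<lambda>t. f (curve s e t))"
      using f by (intro continuous_on_curve[OF s e]) (simp add: circle_maps_def)
    have contr: "contractible {0..1::real}"
      by (simp add: convex_imp_contractible)
    have nz: "f (curve s e t) \<noteq> 0" if "t \<in> {0..1}" for t
      using circle_maps_nonzero[OF f curve_in_carrier[OF e that]] .
    obtain q where q: "continuous_on {0..1} q" "\<And>t. t \<in> {0..1} \<Longrightarrow> f (curve s e t) = (q t)\<^sup>2"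
      by (rule continuous_sqrt_on_contractible[OF cont contr nz]) (assumption, blast)
    have "(q 0)\<^sup>2 = (csqrt (f (curve s e 0)))\<^sup>2"
      using q(2)[of 0] by simp
    then consider "q 0 = csqrt (f (curve s e 0))" | "q 0 = - csqrt (f (curve s e 0))"
      unfolding power2_eq_iff by blast
    then show ?thesis
    proof cases
      case 1 then show ?thesis using q by blast
    next
      case 2
      then have "- q 0 = csqrt (f (curve s e 0))"
        by (metis minus_minus)
      moreover have "continuous_on {0..1} (\<lambda>t. - q t)"
        using q(1) by (rule continuous_on_minus)
      moreover have "\<forall>t\<in>{0..1}. f (curve s e t) = (- q t)\<^sup>2"
        using q(2) unfolding power2_minus by blast
      ultimately show ?thesis by blast
    qed
  qed
  then have "\<forall>e\<in>edges s. \<exists>q. continuous_on {0..1} q \<and> (\<forall>t\<in>{0..1}. f (curve s e t) = (q t)\<^sup>2)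
      \<and> q 0 = csqrt (f (curve s e 0))"
    by blast
  from bchoice[OF this] obtain q where q: "\<And>e. e \<in> edges s \<Longrightarrow> continuous_on {0..1} (q e)"
      "\<And>e t. e \<in> edges s \<Longrightarrow> t \<in> {0..1} \<Longrightarrow> f (curve s e t) = (q e t)\<^sup>2"
      "\<And>e. e \<in> edges s \<Longrightarrow> q e 0 = csqrt (f (curve s e 0))"
    by blast
  define A where "A = {e \<in> edges s. q e 1 \<noteq> csqrt (f (curve s e 1))}"
  \<comment> \<open>The half turn changes the sign of the root at the end of a twisted edge, and its square is the twist.\<close>
  define \<psi> where "\<psi> e t = q e t * (if e \<in> A then exp (pi * \<i> * t) else 1)" for e and t :: real
  have end1: "\<psi> e 1 = csqrt (f (curve s e 1))" if e: "e \<in> edges s" for e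
  proof -
    have "(q e 1)\<^sup>2 = (csqrt (f (curve s e 1)))\<^sup>2"
      using q(2)[OF e, of 1] by simp
    then consider "q e 1 = csqrt (f (curve s e 1))"
      | "q e 1 = - csqrt (f (curve s e 1))" "q e 1 \<noteq> csqrt (f (curve s e 1))"
      unfolding power2_eq_iff by blast
    then show ?thesis
    proof cases
      case 1
      then have "e \<notin> A" by (simp only: A_def mem_Collect_eq) blast
      then show ?thesis using 1 by (simp only: \<psi>_def if_False mult_1_right)
    next
      case 2
      then have "e \<in> A" using e by (simp only: A_def mem_Collect_eq) blast
      then have "\<psi> e 1 = - q e 1" by (simp add: \<psi>_def)
      then show ?thesis using 2(1) by (metis minus_minus)
    qed
  qed
  obtain g where g: "continuous_on (carrier_of s) g"
    "\<And>v. v \<in> verts s \<Longrightarrow> g v = csqrt (f v)"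
    "\<And>e t::real. e \<in> edges s \<Longrightarrow> t \<in> {0..1} \<Longrightarrow> g (curve s e t) = \<psi> e t"
  proof (rule glue_on_graph[OF s, of \<psi> "\<lambda>v. csqrt (f v)"])
    show "continuous_on {0..1} (\<psi> e)" if "e \<in> edges s" for e
      unfolding \<psi>_def by (cases "e \<in> A") (auto intro!: continuous_intros q(1) that)
    show "\<psi> e 0 = csqrt (f (curve s e 0)) \<and> \<psi> e 1 = csqrt (f (curve s e 1))" if "e \<in> edges s" for e
      using q(3)[OF that] end1[OF that] by (simp add: \<psi>_def)
  qed blast
  have "f z * edge_twist s A z = (g z)\<^sup>2" if "z \<in> carrier_of s" for z
    using that
  proof (cases rule: carrier_cases)
    case (2 e t)
    have "(exp (pi * \<i> * t))\<^sup>2 = exp (2 * pi * \<i> * t)"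
      by (simp add: exp_double[symmetric] mult_ac)
    then have "(\<psi> e t)\<^sup>2 = (q e t)\<^sup>2 * (if e \<in> A then exp (2 * pi * \<i> * t) else 1)"
      unfolding \<psi>_def power_mult_distrib by auto
    then show ?thesis
      unfolding 2(3) g(3)[OF 2(1,2)] q(2)[OF 2(1,2)] edge_twist(3)[OF s 2(1,2)] ..
  qed (simp add: g edge_twist[OF s])
  then have "square_on (carrier_of s) (\<lambda>x. f x * edge_twist s A x)"
    using g(1) unfolding square_on_def by blast
  moreover have "A \<subseteq> edges s"
    unfolding A_def by blast
  ultimately show ?thesis by blast
qed

definition coboundary :: "'e plane_graph \<Rightarrow> complex set \<Rightarrow> 'e set" where
  "coboundary s D = {e \<in> edges s. (curve s e 0 \<in> D) \<noteq> (curve s e 1 \<in> D)}"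

lemma exp_half_turns: "exp (pi * \<i> * of_nat k) = (if even k then 1 else - 1)"
proof -
  have "exp (pi * \<i> * of_nat k) = exp (pi * \<i>) ^ k"
    using exp_of_nat_mult[of k "pi * \<i>"] by (simp add: mult_ac)
  then show ?thesis by (simp add: minus_one_power_iff)
qed

text \<open>
  Two twists are congruent modulo squares when their difference is a coboundary: a square root
  has values \<open>1\<close> and \<open>-1\<close> at the vertices, and its sign changes along exactly those edges
  along which the product of the twists winds an odd number of times.
\<close>

lemma square_on_twists_iff:
  assumes s: "embedded_graph \<Sigma> s"
  shows "square_on (carrier_of s) (\<lambda>x. edge_twist s A x * edge_twist s B x) \<longleftrightarrow>
    (\<exists>D\<subseteq>verts s. \<forall>e\<in>edges s. e \<in> coboundary s D \<longleftrightarrow> (e \<in> A) \<noteq> (e \<in> B))"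
proof -
  \<comment> \<open>The number of times the product of the two twists winds along \<open>e\<close>.\<close>
  define k where "k e = (of_bool (e \<in> A) + of_bool (e \<in> B) :: nat)" for e
  have even_k: "even (k e) \<longleftrightarrow> (e \<in> A) = (e \<in> B)" for e
    by (auto simp: k_def)
  have tw: "edge_twist s A (curve s e t) * edge_twist s B (curve s e t) = (exp (pi * \<i> * (k e * t)))\<^sup>2"
    if "e \<in> edges s" "t \<in> {0..1}" for e and t :: real
    using that by (simp add: edge_twist(3)[OF s] k_def exp_double[symmetric] exp_add[symmetric] algebra_simps)
  show ?thesis
  proof
    assume "square_on (carrier_of s) (\<lambda>x. edge_twist s A x * edge_twist s B x)"
    then obtain g where g: "continuous_on (carrier_of s) g"
        "\<And>z. z \<in> carrier_of s \<Longrightarrow> edge_twist s A z * edge_twist s B z = (g z)\<^sup>2"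
      unfolding square_on_def by blast
    have vert: "g v = 1 \<or> g v = - 1" if "v \<in> verts s" for v
    proof -
      have "(g v)\<^sup>2 = 1"
        using g(2)[of v] that edge_twist(2)[OF s that] by (simp add: carrier_of_def)
      then show ?thesis by (simp add: power2_eq_1_iff)
    qed
    define D where "D = {v \<in> verts s. g v = - 1}"
    have "e \<in> coboundary s D \<longleftrightarrow> (e \<in> A) \<noteq> (e \<in> B)" if e: "e \<in> edges s" for e
    proof -
      \<comment> \<open>The root divided by the obvious root of the twists has values \<open>1\<close> and \<open>-1\<close>, hence is constant.\<close>
      define u where "u t = g (curve s e t) / exp (pi * \<i> * (k e * t))" for t :: real
      have "continuous_on {0..1} (\<lambda>t. g (curve s e t))"
        by (rule continuous_on_curve[OF s e g(1)])
      then have contu: "continuous_on {0..1} u"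
        unfolding u_def by (intro continuous_intros) auto
      have "(u t)\<^sup>2 = 1" if "t \<in> {0..1}" for t :: real
        using tw[OF e that] g(2)[OF curve_in_carrier[OF e that]] by (simp add: u_def power_divide)
      then have "u ` {0..1} \<subseteq> {1, - 1}"
        unfolding power2_eq_1_iff by blast
      then have "finite (u ` {0..1})"
        by (rule finite_subset) simp
      then have "u constant_on {0..1}"
        using contu by (simp add: continuous_finite_range_constant)
      then have "u 0 = u 1"
        unfolding constant_on_def by (metis atLeastAtMost_iff order_refl zero_le_one)
      then have "g (curve s e 1) = (if even (k e) then 1 else - 1) * g (curve s e 0)"
        using exp_half_turns[of "k e"] by (auto simp: u_def split: if_splits)
      then show ?thesis
        using vert[OF embedded_graph_curve_ends(1)[OF s e]] embedded_graph_curve_ends[OF s e] e even_k[of e]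
        by (auto simp: coboundary_def D_def)
    qed
    then show "\<exists>D\<subseteq>verts s. \<forall>e\<in>edges s. e \<in> coboundary s D \<longleftrightarrow> (e \<in> A) \<noteq> (e \<in> B)"
      by (intro exI[of _ D]) (auto simp: D_def)
  next
    assume "\<exists>D\<subseteq>verts s. \<forall>e\<in>edges s. e \<in> coboundary s D \<longleftrightarrow> (e \<in> A) \<noteq> (e \<in> B)"
    then obtain D where D: "\<And>e. e \<in> edges s \<Longrightarrow> e \<in> coboundary s D \<longleftrightarrow> (e \<in> A) \<noteq> (e \<in> B)"
      by blast
    define sg where "sg v = (if v \<in> D then - 1 else 1 :: complex)" for v
    obtain g where g: "continuous_on (carrier_of s) g"
      "\<And>v. v \<in> verts s \<Longrightarrow> g v = sg v"
      "\<And>e t::real. e \<in> edges s \<Longrightarrow> t \<in> {0..1} \<Longrightarrow> g (curve s e t) = sg (curve s e 0) * exp (pi * \<i> * (k e * t))"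
    proof (rule glue_on_graph[OF s, of "\<lambda>e (t::real). sg (curve s e 0) * exp (pi * \<i> * (k e * t))" sg])
      show "continuous_on {0..1} (\<lambda>t::real. sg (curve s e 0) * exp (pi * \<i> * (k e * t)))" for e
        by (intro continuous_intros)
      show "sg (curve s e 0) * exp (pi * \<i> * (k e * (0::real))) = sg (curve s e 0) \<and>
          sg (curve s e 0) * exp (pi * \<i> * (k e * (1::real))) = sg (curve s e 1)" if "e \<in> edges s" for e
        using D[OF that] that even_k[of e] exp_half_turns[of "k e"] by (auto simp: coboundary_def sg_def)
    qed blast
    have "edge_twist s A z * edge_twist s B z = (g z)\<^sup>2" if "z \<in> carrier_of s" for z
      using that by (cases rule: carrier_cases) (auto simp: g tw edge_twist(2)[OF s] sg_def power_mult_distrib)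
    then show "square_on (carrier_of s) (\<lambda>x. edge_twist s A x * edge_twist s B x)"
      using g(1) unfolding square_on_def by blast
  qed
qed

text \<open>
  On a connected graph a coboundary determines its set of vertices up to complement. Requiring
  that \<open>v0\<close> be absent selects one set from each complementary pair.
\<close>

lemma card_cohomologous:
  assumes s: "embedded_graph \<Sigma> s" and conn: "connected (carrier_of s)" and v0: "v0 \<in> verts s"
    and A: "A \<subseteq> edges s"
  shows "card {B. B \<subseteq> edges s \<and> (\<exists>D\<subseteq>verts s. \<forall>e\<in>edges s. e \<in> coboundary s D \<longleftrightarrow> (e \<in> A) \<noteq> (e \<in> B))}
    = 2 ^ (card (verts s) - 1)"
proof -
  define \<beta> where "\<beta> D = {e \<in> edges s. (e \<in> A) \<noteq> (e \<in> coboundary s D)}" for D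
  have compl: "coboundary s (verts s - D) = coboundary s D" for D
    using embedded_graph_curve_ends[OF s] unfolding coboundary_def by blast
  have rel: "(\<forall>e\<in>edges s. e \<in> coboundary s D \<longleftrightarrow> (e \<in> A) \<noteq> (e \<in> B)) \<longleftrightarrow> B = \<beta> D"
    if "B \<subseteq> edges s" for B D
    using that by (auto simp: \<beta>_def)
  have half: "\<exists>D'\<in>Pow (verts s - {v0}). \<beta> D' = \<beta> D" if "D \<subseteq> verts s" for D
  proof (cases "v0 \<in> D")
    case True
    then show ?thesis
      by (intro bexI[of _ "verts s - D"]) (auto simp: \<beta>_def compl)
  next
    case False
    then show ?thesis using that by blast
  qed
  have "{B. B \<subseteq> edges s \<and> (\<exists>D\<subseteq>verts s. \<forall>e\<in>edges s. e \<in> coboundary s D \<longleftrightarrow> (e \<in> A) \<noteq> (e \<in> B))}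
      = {B. B \<subseteq> edges s \<and> (\<exists>D\<subseteq>verts s. B = \<beta> D)}"
    using rel by auto
  also have "\<dots> = \<beta> ` Pow (verts s)"
    by (auto simp: \<beta>_def)
  also have "\<dots> = \<beta> ` Pow (verts s - {v0})"
  proof
    show "\<beta> ` Pow (verts s) \<subseteq> \<beta> ` Pow (verts s - {v0})"
      using half by (metis PowD image_eqI image_subsetI)
  qed blast
  finally have "{B. B \<subseteq> edges s \<and> (\<exists>D\<subseteq>verts s. \<forall>e\<in>edges s. e \<in> coboundary s D \<longleftrightarrow> (e \<in> A) \<noteq> (e \<in> B))}
      = \<beta> ` Pow (verts s - {v0})" .
  moreover have "inj_on \<beta> (Pow (verts s - {v0}))"
  proof (rule inj_onI)
    fix D D' assume D: "D \<in> Pow (verts s - {v0})" "D' \<in> Pow (verts s - {v0})" "\<beta> D = \<beta> D'"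
    have "e \<in> coboundary s D \<longleftrightarrow> e \<in> coboundary s D'" if "e \<in> edges s" for e
      using D(3) that unfolding \<beta>_def by blast
    then have "\<forall>e\<in>edges s. (curve s e 0 \<in> D \<longleftrightarrow> curve s e 0 \<in> D') = (curve s e 1 \<in> D \<longleftrightarrow> curve s e 1 \<in> D')"
      unfolding coboundary_def by blast
    from constant_on_connected_graph[OF s conn, of "\<lambda>v. v \<in> D \<longleftrightarrow> v \<in> D'", OF this]
    obtain c where "\<forall>v\<in>verts s. (v \<in> D \<longleftrightarrow> v \<in> D') = c" by blast
    then have "\<forall>v\<in>verts s. v \<in> D \<longleftrightarrow> v \<in> D'" using v0 D by blast
    then show "D = D'" using D by blast
  qed
  ultimately show ?thesis
    using s v0 by (simp add: card_image card_Pow embedded_graph_def)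
qed

text \<open>
  Pulling edge twists back along the retraction maps the sets of edges onto the square classes of
  \<open>S\<close>, because every map on \<open>S\<close> is homotopic to its composition with the retraction. Each fibre is a
  coset of the coboundaries.
\<close>

theorem card_square_classes:
  assumes s: "embedded_graph \<Sigma> s" and conn: "connected (carrier_of s)" and ne: "verts s \<noteq> {}"
    and retr: "deformation_retracts_onto S (carrier_of s)"
  shows "card (circle_maps S // square_rel S) * 2 ^ (card (verts s) - 1) = 2 ^ card (edges s)"
proof -
  obtain r where r: "homotopic_with_canon (\<lambda>_. True) S S id r" "carrier_of s \<subseteq> S"
      "continuous_on S r" "r \<in> S \<rightarrow> carrier_of s" "\<And>x. x \<in> carrier_of s \<Longrightarrow> r x = x"
    using retr unfolding deformation_retracts_onto_def retraction_def by blast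
  obtain v0 where v0: "v0 \<in> verts s" using ne by blast
  have finE: "finite (edges s)" using s by (simp add: embedded_graph_def)
  define F where "F A = (\<lambda>x. edge_twist s A (r x))" for A
  define cls where "cls A = square_rel S `` {F A}" for A
  have F: "F A \<in> circle_maps S" for A
    unfolding F_def by (rule circle_maps_compose[OF edge_twist(1)[OF s] r(3,4)])
  have onto: "cls ` Pow (edges s) = circle_maps S // square_rel S"
  proof
    show "cls ` Pow (edges s) \<subseteq> circle_maps S // square_rel S"
      using F by (auto simp: cls_def intro: quotientI)
    show "circle_maps S // square_rel S \<subseteq> cls ` Pow (edges s)"
    proof
      fix k assume "k \<in> circle_maps S // square_rel S"
      then obtain f where f: "f \<in> circle_maps S" "k = square_rel S `` {f}"
        by (auto elim: quotientE)
      then have "f \<in> circle_maps (carrier_of s)"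
        using r(2) by (auto simp: circle_maps_def intro: continuous_on_subset)
      from square_on_graph_twist[OF s this] obtain A where A: "A \<subseteq> edges s"
          "square_on (carrier_of s) (\<lambda>x. f x * edge_twist s A x)"
        by blast
      have fr: "(\<lambda>x. f (r x)) \<in> circle_maps S"
        using circle_maps_compose[OF f(1) r(3)] r(2,4) by blast
      have "square_on S (\<lambda>x. f (r x) * F A x)"
        using square_on_compose[OF A(2) r(3,4)] by (simp add: F_def)
      from square_on_trans[OF square_on_homotopic[OF f(1) r(1)] this fr]
      have "(f, F A) \<in> square_rel S"
        using f(1) F by (simp add: square_rel_def)
      then have "k = cls A"
        unfolding f(2) cls_def by (rule equiv_class_eq[OF equiv_square_rel])
      then show "k \<in> cls ` Pow (edges s)" using A by blast
    qed
  qed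
  have same: "cls B = cls A \<longleftrightarrow> (\<exists>D\<subseteq>verts s. \<forall>e\<in>edges s. e \<in> coboundary s D \<longleftrightarrow> (e \<in> A) \<noteq> (e \<in> B))" for A B
  proof -
    have "cls B = cls A \<longleftrightarrow> (F A, F B) \<in> square_rel S"
      unfolding cls_def using eq_equiv_class_iff[OF equiv_square_rel F F] by metis
    also have "\<dots> \<longleftrightarrow> square_on S (\<lambda>x. F A x * F B x)"
      using F by (simp add: square_rel_def)
    also have "\<dots> \<longleftrightarrow> square_on (carrier_of s) (\<lambda>x. edge_twist s A x * edge_twist s B x)"
    proof
      assume "square_on S (\<lambda>x. F A x * F B x)"
      then have "square_on (carrier_of s) (\<lambda>x. F A x * F B x)"
        using square_on_compose[OF _ continuous_on_id, of S _ "carrier_of s"] r(2) by auto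
      then show "square_on (carrier_of s) (\<lambda>x. edge_twist s A x * edge_twist s B x)"
        by (subst (asm) square_on_cong) (auto simp: F_def r(5))
    next
      assume "square_on (carrier_of s) (\<lambda>x. edge_twist s A x * edge_twist s B x)"
      from square_on_compose[OF this r(3,4)] show "square_on S (\<lambda>x. F A x * F B x)"
        by (simp add: F_def)
    qed
    finally show ?thesis
      unfolding square_on_twists_iff[OF s] .
  qed
  have "2 ^ card (edges s) = (\<Sum>B\<in>Pow (edges s). 1 :: nat)"
    using finE by (simp add: card_Pow)
  also have "\<dots> = (\<Sum>k\<in>cls ` Pow (edges s). \<Sum>B\<in>{B. B \<in> Pow (edges s) \<and> cls B = k}. 1)"
    using finE by (intro sum.image_gen) simp
  also have "\<dots> = (\<Sum>k\<in>cls ` Pow (edges s). 2 ^ (card (verts s) - 1))"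
  proof (rule sum.cong[OF refl])
    fix k assume "k \<in> cls ` Pow (edges s)"
    then obtain A where "A \<subseteq> edges s" "k = cls A" by blast
    then show "(\<Sum>B\<in>{B. B \<in> Pow (edges s) \<and> cls B = k}. 1) = (2::nat) ^ (card (verts s) - 1)"
      using card_cohomologous[OF s conn v0, of A] by (simp add: same)
  qed
  finally show ?thesis
    unfolding onto by simp
qed

lemma spine_connected:
  assumes "spine \<Sigma> M s" "connected \<Sigma>"
  shows "connected (carrier_of s)"
proof -
  obtain r where r: "continuous_on \<Sigma> r" "carrier_of s \<subseteq> \<Sigma>" "r \<in> \<Sigma> \<rightarrow> carrier_of s" "\<And>x. x \<in> carrier_of s \<Longrightarrow> r x = x"
    using assms(1) unfolding spine_def deformation_retracts_onto_def retraction_def by blast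
  have "carrier_of s \<subseteq> r ` \<Sigma>"
  proof
    fix x assume "x \<in> carrier_of s"
    then show "x \<in> r ` \<Sigma>" using r(2,4) by (metis image_eqI subsetD)
  qed
  then have "r ` \<Sigma> = carrier_of s" using r(3) by blast
  then show ?thesis
    using connected_continuous_image[OF r(1) assms(2)] by simp
qed

text \<open>
  The number of square classes belongs to \<open>\<Sigma>\<close> alone and determines the Euler characteristic of
  any connected graph with vertices onto which \<open>\<Sigma>\<close> deformation retracts.
\<close>

theorem euler_characteristic_spines:
  fixes s :: "'e plane_graph" and s' :: "'f plane_graph"
  assumes "spine \<Sigma> M s" "spine \<Sigma> M s'" "connected \<Sigma>" "verts s \<noteq> {}" "verts s' \<noteq> {}"
  shows "card (verts s) + card (edges s') = card (verts s') + card (edges s)"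
proof -
  let ?N = "card (circle_maps \<Sigma> // square_rel \<Sigma>)"
  have *: "?N * 2 ^ (card (verts s) - 1) = 2 ^ card (edges s)" "?N * 2 ^ (card (verts s') - 1) = 2 ^ card (edges s')"
    using card_square_classes spine_connected assms unfolding spine_def by metis+
  have "(2::nat) ^ (card (edges s) + (card (verts s') - 1)) = ?N * 2 ^ (card (verts s) - 1) * 2 ^ (card (verts s') - 1)"
    unfolding power_add *(1)[symmetric] ..
  also have "\<dots> = 2 ^ (card (edges s') + (card (verts s) - 1))"
    unfolding power_add *(2)[symmetric] by (simp only: mult_ac)
  finally have "card (edges s) + (card (verts s') - 1) = card (edges s') + (card (verts s) - 1)"
    by simp
  moreover have "card (verts s) > 0" "card (verts s') > 0"
    using assms by (auto simp: spine_def embedded_graph_def card_gt_0_iff)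
  ultimately show ?thesis by linarith
qed

section \<open>Holed disks are connected\<close>

text \<open>
  In a separation of \<open>S - B\<close> the connected frontier of \<open>B\<close> lies on one side, so adding \<open>B\<close> to this
  side would separate \<open>S\<close>.
\<close>

lemma connected_diff_open:
  fixes S B :: "'a::topological_space set"
  assumes S: "connected S" and B: "open B" "closure B \<subseteq> S" and fr: "connected (frontier B)"
  shows "connected (S - B)"
  unfolding connected_closed
proof (rule ccontr)
  assume "\<not> \<not> (\<exists>P Q. closed P \<and> closed Q \<and> S - B \<subseteq> P \<union> Q \<and> P \<inter> Q \<inter> (S - B) = {} \<and>
      P \<inter> (S - B) \<noteq> {} \<and> Q \<inter> (S - B) \<noteq> {})"
  then obtain P Q where PQ: "closed P" "closed Q" "S - B \<subseteq> P \<union> Q" "P \<inter> Q \<inter> (S - B) = {}"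
      "P \<inter> (S - B) \<noteq> {}" "Q \<inter> (S - B) \<noteq> {}"
    by blast
  have False if "closed P" "closed Q" "S - B \<subseteq> P \<union> Q" "P \<inter> Q \<inter> (S - B) = {}"
      "P \<inter> (S - B) \<noteq> {}" "Q \<inter> (S - B) \<noteq> {}" "frontier B \<inter> Q = {}" for P Q
  proof -
    have cl: "closure B = B \<union> frontier B" "frontier B \<inter> B = {}"
      using B(1) by (auto simp: frontier_def interior_open closure_subset[THEN subsetD])
    have "closed (P - B \<union> closure B)" "closed (Q - B)"
      using that B(1) by (auto intro: closed_Diff)
    moreover have "S \<subseteq> (P - B \<union> closure B) \<union> (Q - B)"
      using that(3) closure_subset by blast
    moreover have "(P - B \<union> closure B) \<inter> (Q - B) \<inter> S = {}"
      using that(4,7) cl by blast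
    moreover have "(P - B \<union> closure B) \<inter> S \<noteq> {}" "(Q - B) \<inter> S \<noteq> {}"
      using that(5,6) by blast+
    ultimately show False
      using S unfolding connected_closed by blast
  qed
  note contra = this
  have "frontier B \<subseteq> S - B"
    using B by (auto simp: frontier_def interior_open)
  then have "frontier B \<subseteq> P \<union> Q" "P \<inter> Q \<inter> frontier B = {}"
    using PQ by blast+
  then have "frontier B \<inter> Q = {} \<or> frontier B \<inter> P = {}"
    using fr PQ(1,2) unfolding connected_closed by blast
  then show False
    using contra[of P Q] contra[of Q P] PQ by (auto simp: Int_ac Un_ac)
qed

lemma plane_smooth_on_continuous:
  assumes "plane_smooth_on U f"
  shows "continuous_on U f"
proof -
  obtain D :: "nat \<Rightarrow> nat \<Rightarrow> complex \<Rightarrow> complex" where D: "\<forall>z\<in>U. D 0 0 z = f z"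
      "\<forall>z\<in>U. (D 0 0 has_derivative (\<lambda>w. Re w *\<^sub>R D (Suc 0) 0 z + Im w *\<^sub>R D 0 (Suc 0) z)) (at z)"
    using assms unfolding plane_smooth_on_def by blast
  then have "continuous_on U (D 0 0)"
    by (intro continuous_at_imp_continuous_on) (auto dest: has_derivative_continuous)
  then show ?thesis
    by (rule continuous_on_eq) (use D in auto)
qed

text \<open>
  The frontier is the image of the unit circle, since the parametrisation extends injectively to
  the closed disk.
\<close>

lemma smooth_open_disk_topology:
  assumes "smooth_open_disk B"
  shows "open B" "connected (frontier B)"
proof -
  obtain U f g where U: "cball 0 1 \<subseteq> U" "open (f ` U)" "plane_smooth_on U f" "plane_smooth_on (f ` U) g"
      "\<forall>z\<in>U. g (f z) = z" "B = f ` ball 0 1"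
    using assms unfolding smooth_open_disk_def by blast
  have contf: "continuous_on (cball 0 1) f"
    using plane_smooth_on_continuous[OF U(3)] U(1) by (rule continuous_on_subset)
  have inj: "inj_on f (cball 0 1)"
    using U(1,5) by (intro inj_on_inverseI[of _ g]) auto
  have b: "ball 0 1 \<subseteq> (cball 0 1 :: complex set)" by auto
  have "open (f ` U \<inter> g -` ball 0 1)"
    using plane_smooth_on_continuous[OF U(4)] U(2) by (intro continuous_open_preimage) auto
  also have "f ` U \<inter> g -` ball 0 1 = f ` {z \<in> U. z \<in> ball 0 1}"
    using U(5) by auto
  also have "{z \<in> U. z \<in> ball 0 1} = ball 0 1"
    using U(1) b by blast
  also have "f ` ball 0 1 = B"
    using U(6) by simp
  finally show oB: "open B" .
  have "closure B = f ` cball 0 1"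
  proof
    have "closed (f ` cball 0 1)"
      using contf by (intro compact_imp_closed compact_continuous_image) auto
    then show "closure B \<subseteq> f ` cball 0 1"
      using U(6) b by (intro closure_minimal) auto
    have "f ` closure (ball 0 1) \<subseteq> closure (f ` ball 0 1)"
      using contf by (intro image_closure_subset) (auto simp: closure_subset)
    then show "f ` cball 0 1 \<subseteq> closure B"
      using U(6) by simp
  qed
  then have "frontier B = f ` cball 0 1 - f ` ball 0 1"
    using oB U(6) by (simp add: frontier_def interior_open)
  also have "\<dots> = f ` (cball 0 1 - ball 0 1)"
    using inj b by (intro inj_on_image_set_diff[symmetric]) auto
  also have "cball 0 1 - ball 0 1 = (sphere 0 1 :: complex set)"
    by auto
  finally have "frontier B = f ` sphere 0 1" .
  moreover have "connected (f ` sphere 0 1)"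
    using contf by (intro connected_continuous_image connected_sphere) (auto intro: continuous_on_subset)
  ultimately show "connected (frontier B)" by simp
qed

text \<open>
  The holes are removed one at a time; the disjointness of their closures keeps each closure
  inside what is left.
\<close>

lemma connected_holed_disk:
  assumes "holed_disk h \<Sigma>"
  shows "connected \<Sigma>"
proof -
  obtain B where B: "\<And>i. i < h \<Longrightarrow> smooth_open_disk (B i)" "\<And>i. i < h \<Longrightarrow> closure (B i) \<subseteq> ball 0 1"
      "\<And>i j. i < h \<Longrightarrow> j < h \<Longrightarrow> i \<noteq> j \<Longrightarrow> closure (B i) \<inter> closure (B j) = {}"
      "\<Sigma> = cball 0 1 - (\<Union>i<h. B i)"
    using assms unfolding holed_disk_def by metis
  have "connected (cball 0 1 - (\<Union>i<k. B i))" if "k \<le> h" for k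
    using that
  proof (induction k)
    case (Suc k)
    have "closure (B k) \<subseteq> cball 0 1 - (\<Union>i<k. B i)"
    proof -
      have "closure (B k) \<inter> B i = {}" if "i < k" for i
        using B(3)[of k i] that Suc.prems closure_subset[of "B i"] by auto
      then show ?thesis
        using B(2)[of k] Suc.prems by fastforce
    qed
    moreover have "smooth_open_disk (B k)" "connected (cball 0 1 - (\<Union>i<k. B i))"
      using Suc B(1) by auto
    ultimately have "connected (cball 0 1 - (\<Union>i<k. B i) - B k)"
      using connected_diff_open smooth_open_disk_topology by blast
    also have "cball 0 1 - (\<Union>i<k. B i) - B k = cball 0 1 - (\<Union>i<Suc k. B i)"
      by (auto simp: less_Suc_eq)
    finally show ?case .
  qed auto
  then show ?thesis
    using B(4) by simp
qed

lemma holed_disk_nonempty: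
  assumes "holed_disk h \<Sigma>"
  shows "\<Sigma> \<noteq> {}"
proof -
  obtain B where B: "\<And>i. i < h \<Longrightarrow> closure (B i) \<subseteq> ball 0 1" "\<Sigma> = cball 0 1 - (\<Union>i<h. B i)"
    using assms unfolding holed_disk_def by metis
  \<comment> \<open>The point \<open>1\<close> lies on the outer circle.\<close>
  have "1 \<notin> B i" if "i < h" for i
    using B(1)[OF that] closure_subset[of "B i"] by auto
  then have "1 \<in> \<Sigma>" using B(2) by auto
  then show ?thesis by blast
qed

section \<open>Counting colorings\<close>

lemma sum_shift_labels:
  fixes f :: "nat \<Rightarrow> real"
  assumes "n > 1"
  shows "(\<Sum>a\<in>{0..n - 2}. f (Suc a)) = (\<Sum>k = 1..<n. f k)"
proof -
  have "(\<Sum>k = 1..<n. f k) = (\<Sum>k = Suc 0..<Suc (n - 1). f k)"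
    using assms by simp
  also have "\<dots> = (\<Sum>a = 0..<n - 1. f (Suc a))"
    by (rule sum.shift_bounds_Suc_ivl)
  also have "{0..<n - 1} = {0..n - 2}"
    using assms by auto
  finally show ?thesis by simp
qed

text \<open>
  The indicator of the coloring condition is a product over the vertices of factors to which
  \<open>verlinde_state_sum\<close> applies. A trivalent vertex has \<open>W = 1\<close> by the Verlinde formula.
  At a marked point the label is unrestricted; there \<open>W\<close> is the sum of all labels in the fusion
  ring, whose pairing with each single label is \<open>1\<close>.
\<close>

theorem card_colorings:
  assumes n: "n > 1" and s: "embedded_graph \<Sigma> s" and conn: "connected (carrier_of s)"
    and ne: "verts s \<noteq> {}"
    and M: "{v \<in> verts s. vdegree s v = 1} = M" "\<forall>v\<in>verts s - M. vdegree s v = 3"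
  shows "real (card (colorings n s)) = (\<Sum>j = 1..<n. (\<Sum>b = 1..<n. quantum_int n b j) ^ card M
      * verlinde_weight n j ^ card (verts s) / verlinde_weight n j ^ card (edges s))"
proof -
  let ?q = "\<lambda>a j. quantum_int n (Suc a) j"
  define W where "W v j = (if v \<in> M then \<Sum>b = 1..<n. quantum_int n b j else 1)" for v :: complex and j
  define vertex_factor where "vertex_factor c v = (\<Sum>j = 1..<n. verlinde_weight n j * W v j * (\<Prod>h\<in>half_edges s v. ?q (c (fst h)) j))"
    for c v
  have finV: "finite (verts s)" and finE: "finite (edges s)"
    using s by (auto simp: embedded_graph_def)
  have MV: "M \<subseteq> verts s" using M(1) by blast
  have prod_W: "(\<Prod>v\<in>verts s. W v j) = (\<Sum>b = 1..<n. quantum_int n b j) ^ card M" for j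
    using finV MV by (simp add: W_def prod.If_cases Int_absorb1)
  have range: "c (fst h) \<le> n - 2" if "c \<in> edges s \<rightarrow>\<^sub>E {0..n - 2}" "h \<in> half_edges s v" for c h v
    using that by (auto simp: half_edges_def)
  have leaf: "vertex_factor c v = 1" if c: "c \<in> edges s \<rightarrow>\<^sub>E {0..n - 2}" and v: "v \<in> M" for c v
  proof -
    have "card (half_edges s v) = 1"
      using v M(1) by (auto simp: vdegree_def)
    then obtain h where h: "half_edges s v = {h}"
      by (rule card_1_singletonE)
    have "c (fst h) \<le> n - 2"
      using range[OF c, of h v] h by simp
    have "vertex_factor c v = (\<Sum>j = 1..<n. \<Sum>b = 1..<n. verlinde_weight n j * quantum_int n b j * ?q (c (fst h)) j)"
      unfolding vertex_factor_def W_def h using v by (simp add: sum_distrib_left sum_distrib_right)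
    also have "\<dots> = (\<Sum>b = 1..<n. \<Sum>j = 1..<n. verlinde_weight n j * quantum_int n b j * ?q (c (fst h)) j)"
      by (rule sum.swap)
    also have "\<dots> = (\<Sum>b = 1..<n. if b = Suc (c (fst h)) then 1 else 0)"
      by (rule sum.cong[OF refl], rule quantum_int_orthonormal)
        (use n \<open>c (fst h) \<le> n - 2\<close> in auto)
    also have "\<dots> = 1"
      using n \<open>c (fst h) \<le> n - 2\<close> by (simp add: sum.delta)
    finally show ?thesis .
  qed
  have inner: "vertex_factor c v = of_bool (q_admissible n (c (fst x)) (c (fst y)) (c (fst z)))"
    if c: "c \<in> edges s \<rightarrow>\<^sub>E {0..n - 2}" and v: "v \<notin> M" and deg: "vdegree s v = 3" and h: "half_edges s v = {x, y, z}" for c v x y z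
  proof -
    have "card {x, y, z} = 3"
      using deg h by (simp add: vdegree_def)
    then have dist: "x \<noteq> y" "x \<noteq> z" "y \<noteq> z"
      by (auto simp: card_insert_if split: if_splits)
    have le: "c (fst x) \<le> n - 2" "c (fst y) \<le> n - 2" "c (fst z) \<le> n - 2"
      using range[OF c, of _ v] h by auto
    have "vertex_factor c v = (\<Sum>j = 1..<n. verlinde_weight n j * ?q (c (fst x)) j * ?q (c (fst y)) j * ?q (c (fst z)) j)"
      unfolding vertex_factor_def W_def h using v dist by (simp add: mult.assoc)
    also have "\<dots> = of_bool (fusion n (Suc (c (fst x))) (Suc (c (fst y))) (Suc (c (fst z))))"
      by (rule verlinde_fusion) (use le n in auto)
    finally show ?thesis
      using q_admissible_iff_fusion[OF n] le by simp
  qed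
  have count: "(\<Prod>v\<in>verts s. vertex_factor c v) = of_bool (c \<in> colorings n s)"
    if c: "c \<in> edges s \<rightarrow>\<^sub>E {0..n - 2}" for c
  proof (cases "c \<in> colorings n s")
    case True
    have "vertex_factor c v = 1" if v: "v \<in> verts s" for v
    proof (cases "v \<in> M")
      case False
      then have deg: "vdegree s v = 3" using M(2) v by blast
      then obtain x y z where h: "half_edges s v = {x, y, z}"
        unfolding vdegree_def card_3_iff by blast
      then have "q_admissible n (c (fst x)) (c (fst y)) (c (fst z))"
        using True v deg unfolding colorings_def by blast
      then show ?thesis using inner[OF c False deg h] by simp
    qed (use leaf[OF c] in blast)
    then show ?thesis using True by simp
  next
    case False
    then obtain v x y z where v: "v \<in> verts s" "vdegree s v = 3" "half_edges s v = {x, y, z}"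
        "\<not> q_admissible n (c (fst x)) (c (fst y)) (c (fst z))"
      using c unfolding colorings_def by blast
    then have "v \<notin> M" using M(1) by auto
    then have "vertex_factor c v = 0" using inner[OF c _ v(2,3)] v(4) by simp
    then have "(\<Prod>v\<in>verts s. vertex_factor c v) = 0" using v(1) finV by (auto simp: prod_zero_iff)
    then show ?thesis using False by simp
  qed
  have sub: "colorings n s \<subseteq> edges s \<rightarrow>\<^sub>E {0..n - 2}"
    unfolding colorings_def by blast
  have fin: "finite (edges s \<rightarrow>\<^sub>E {0..n - 2})"
    using finE by (intro finite_PiE) auto
  have "real (card (colorings n s)) = (\<Sum>c\<in>edges s \<rightarrow>\<^sub>E {0..n - 2}. of_bool (c \<in> colorings n s))"
    using fin sub by (simp add: Int_absorb1)
  also have "\<dots> = (\<Sum>c\<in>edges s \<rightarrow>\<^sub>E {0..n - 2}. \<Prod>v\<in>verts s. vertex_factor c v)"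
    by (rule sum.cong[OF refl]) (simp add: count)
  also have "\<dots> = (\<Sum>j = 1..<n. (\<Prod>v\<in>verts s. W v j) * verlinde_weight n j ^ card (verts s) / verlinde_weight n j ^ card (edges s))"
    unfolding vertex_factor_def half_edges_def
  proof (rule verlinde_state_sum)
    show "\<exists>k. \<forall>v\<in>verts s. f v = k" if "\<forall>e\<in>edges s. f (curve s e 0) = f (curve s e 1)" for f :: "complex \<Rightarrow> nat"
      using constant_on_connected_graph[OF s conn that] .
    show "(\<Sum>a\<in>{0..n - 2}. ?q a i * ?q a j) = (if i = j then 1 / verlinde_weight n i else 0)"
      if "i \<in> {1..<n}" "j \<in> {1..<n}" for i j
      using sum_shift_labels[OF n, of "\<lambda>k. quantum_int n k i * quantum_int n k j"]
        quantum_int_complete[of i n j] that by simp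
  qed (use finV finE ne embedded_graph_curve_ends[OF s] in auto)
  finally show ?thesis
    unfolding prod_W .
qed

text \<open>
  A graph without vertices has no edges, and a nonempty space does not retract onto the empty set.
\<close>

lemma trivalent_spine_nonempty:
  assumes "trivalent_spine \<Sigma> M s" "\<Sigma> \<noteq> {}"
  shows "verts s \<noteq> {}"
proof
  assume "verts s = {}"
  then have "edges s = {}"
    using assms(1) by (auto simp: trivalent_spine_def spine_def embedded_graph_def)
  then have "carrier_of s = {}"
    using \<open>verts s = {}\<close> by (simp add: carrier_of_def)
  then show False
    using assms by (auto simp: trivalent_spine_def spine_def deformation_retracts_onto_def retraction_def)
qed

lemma cmodule_isomorphic_free:
  fixes X :: "'a set" and Y :: "'b set"
  assumes "finite X" "finite Y" "card X = card Y"
  shows "cmodule_isomorphic (free_cmodule X) (free_cmodule Y)"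
proof -
  obtain b where b: "bij_betw b Y X"
    using assms finite_same_card_bij by metis
  define \<phi> :: "('a \<Rightarrow>\<^sub>0 complex) \<Rightarrow> ('b \<Rightarrow>\<^sub>0 complex)"
    where "\<phi> x = Abs_poly_mapping (\<lambda>y. if y \<in> Y then Poly_Mapping.lookup x (b y) else 0)" for x
  have look: "Poly_Mapping.lookup (\<phi> x) y = (if y \<in> Y then Poly_Mapping.lookup x (b y) else 0)" for x y
    unfolding \<phi>_def
    by (subst lookup_Abs_poly_mapping) (auto intro: finite_subset[OF _ assms(2)])
  show ?thesis
    unfolding cmodule_isomorphic_def
  proof (intro exI[of _ \<phi>] conjI ballI allI)
    show "bij_betw \<phi> (free_cmodule X) (free_cmodule Y)"
    proof (rule bij_betwI[where g = "\<lambda>z. Abs_poly_mapping (\<lambda>x. if x \<in> X then Poly_Mapping.lookup z (inv_into Y b x) else 0)"])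
      let ?g = "\<lambda>z. Abs_poly_mapping (\<lambda>x. if x \<in> X then Poly_Mapping.lookup z (inv_into Y b x) else 0)"
      have lookg: "Poly_Mapping.lookup (?g z) x = (if x \<in> X then Poly_Mapping.lookup z (inv_into Y b x) else 0)" for z x
        by (subst lookup_Abs_poly_mapping) (auto intro: finite_subset[OF _ assms(1)])
      show "\<phi> \<in> free_cmodule X \<rightarrow> free_cmodule Y" "?g \<in> free_cmodule Y \<rightarrow> free_cmodule X"
        by (auto simp: free_cmodule_def in_keys_iff look lookg split: if_splits)
      show "?g (\<phi> x) = x" if "x \<in> free_cmodule X" for x
        using that b bij_betw_inv_into_right[OF b] bij_betw_apply[OF bij_betw_inv_into[OF b]]
        by (intro poly_mapping_eqI) (auto simp: lookg look free_cmodule_def in_keys_iff)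
      show "\<phi> (?g y) = y" if "y \<in> free_cmodule Y" for y
        using that b bij_betw_inv_into_left[OF b] bij_betw_apply[OF b]
        by (intro poly_mapping_eqI) (auto simp: lookg look free_cmodule_def in_keys_iff)
    qed
  qed (auto intro!: poly_mapping_eqI simp: look lookup_add lookup_cscale)
qed

theorem theorem6p0p10:
  fixes n h :: nat and \<Sigma> M :: "complex set"
    and s :: "'e plane_graph" and s' :: "'f plane_graph"
  assumes "n > 1"
    and "marked_holed_disk h \<Sigma> M"
    and "trivalent_spine \<Sigma> M s" and "trivalent_spine \<Sigma> M s'"
  shows "cmodule_isomorphic (skein_module n s) (skein_module n s')"
proof -
  have disk: "holed_disk h \<Sigma>"
    using assms(2) by (simp add: marked_holed_disk_def)
  note conn = connected_holed_disk[OF disk]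
  note ne = trivalent_spine_nonempty[OF assms(3) holed_disk_nonempty[OF disk]]
    trivalent_spine_nonempty[OF assms(4) holed_disk_nonempty[OF disk]]
  have sp: "spine \<Sigma> M s" "spine \<Sigma> M s'"
    using assms(3,4) by (auto simp: trivalent_spine_def)
  note euler = euler_characteristic_spines[OF sp conn ne]
  have "verlinde_weight n j ^ card (verts s) / verlinde_weight n j ^ card (edges s)
      = verlinde_weight n j ^ card (verts s') / verlinde_weight n j ^ card (edges s')" if "j \<in> {1..<n}" for j
    using verlinde_weight_pos[of j n] that euler
    by (simp add: field_simps power_add[symmetric])
  moreover have "real (card (colorings n s)) = (\<Sum>j = 1..<n. (\<Sum>b = 1..<n. quantum_int n b j) ^ card M
      * verlinde_weight n j ^ card (verts s) / verlinde_weight n j ^ card (edges s))"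
    using assms(1,3) spine_connected[OF sp(1) conn] ne(1)
    by (intro card_colorings) (auto simp: trivalent_spine_def spine_def)
  moreover have "real (card (colorings n s')) = (\<Sum>j = 1..<n. (\<Sum>b = 1..<n. quantum_int n b j) ^ card M
      * verlinde_weight n j ^ card (verts s') / verlinde_weight n j ^ card (edges s'))"
    using assms(1,4) spine_connected[OF sp(2) conn] ne(2)
    by (intro card_colorings) (auto simp: trivalent_spine_def spine_def)
  ultimately have "real (card (colorings n s)) = real (card (colorings n s'))"
    by (simp add: times_divide_eq_right[symmetric] del: times_divide_eq_right)
  moreover have "finite (colorings n s)" "finite (colorings n s')"
  proof -
    have "finite (edges s \<rightarrow>\<^sub>E {0..n - 2})" "finite (edges s' \<rightarrow>\<^sub>E {0..n - 2})"
      using sp by (auto simp: spine_def embedded_graph_def intro!: finite_PiE)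
    then show "finite (colorings n s)" "finite (colorings n s')"
      unfolding colorings_def by auto
  qed
  ultimately show ?thesis
    unfolding skein_module_def by (intro cmodule_isomorphic_free) auto
qed

end
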